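(* The following hold: $\lambda_\mathbb{R}(2)=\frac{4}{3}$; $\lambda_\mathbb{R}(3)=\frac{1+\sqrt5}{2}$; $\lambda_\mathbb{R}(7)=\frac{5}{2}$; $\lambda_\mathbb{R}(23)=\frac{14}{3}$.
   Context: For a real Banach space $X$ and a finite-dimensional subspace $Y\subset X$, let $\lambda_\mathbb{R}(Y,X)=\inf\{\|P\|\}$ over all bounded linear projections $P$ from $X$ onto $Y$; let $\lambda_\mathbb{R}(Y)=\sup\{\lambda_\mathbb{R}(Y,X):Y\subset X\}$ (over all real Banach spaces $X$ containing $Y$ isometrically); and let $\lambda_\mathbb{R}(m)=\sup\{\lambda_\mathbb{R}(Y):\dim Y=m\}$, the maximal absolute projection constant. *)

theory Defs
  imports "HOL-Analysis.Analysis"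
begin

definition fin_dim_subspace :: "nat \<Rightarrow> 'a::real_vector set \<Rightarrow> bool" where
  "fin_dim_subspace m Y \<longleftrightarrow> subspace Y \<and>
     (\<exists>B. finite B \<and> independent B \<and> span B = Y \<and> card B = m)"

definition rel_proj_const :: "'a::real_normed_vector set \<Rightarrow> real" where
  "rel_proj_const Y = Inf {onorm P | P. bounded_linear P \<and> range P = Y \<and> (\<forall>y\<in>Y. P y = y)}"

text \<open>lambda_R(m) = c: every m-dimensional subspace Y of every real Banach space X
  (ranging over all types of class banach, universally quantified at the theorem
  level) has lambda(Y,X) <= c, and the supremum c is attained as a supremum already
  over pairs (Y, l_infinity) (l_infinity = bounded functions nat => real), which is
  one particular admissible Banach space X.\<close>
type_synonym linf = "nat \<Rightarrow>\<^sub>C real"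

definition linf_max_proj_const :: "nat \<Rightarrow> real" where
  "linf_max_proj_const m = (SUP Y \<in> {Y::linf set. fin_dim_subspace m Y}. rel_proj_const Y)"

end

theory Submission
  imports Defs
begin

text \<open>
  Put \<open>\<alpha> = 1 / sqrt (m + 2)\<close> and \<open>C = (1 - \<alpha>) * (1 + 2*\<alpha>) / (\<alpha> * (1 + \<alpha>))\<close>; then \<open>C\<close> is \<open>4/3\<close>,
  \<open>(1 + sqrt 5)/2\<close>, \<open>5/2\<close> and \<open>14/3\<close> for \<open>m = 2, 3, 7, 23\<close>.

  Upper bound. Finitely many norm one functionals \<open>f\<^sub>i\<close> almost norm \<open>Y\<close>, and a projection has the form
  \<open>x \<mapsto> \<Sum> f\<^sub>i(x) z\<^sub>i\<close> with \<open>\<Sum> f\<^sub>i(y) z\<^sub>i = y\<close> on \<open>Y\<close>. By a minimax argument it suffices to find, for each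
  system of weights \<open>w\<close>, such \<open>z\<^sub>i\<close> with \<open>\<Sum> w\<^sub>k \<bar>f\<^sub>k(z\<^sub>i)\<bar> \<le> C\<close>. Choosing a basis of \<open>Y\<close> orthonormal for
  \<open>\<Sum> w\<^sub>i f\<^sub>i\<^sup>2\<close> turns the \<open>f\<^sub>i\<close> into an isotropic system of vectors \<open>x\<^sub>i\<close> in \<open>\<real>\<^sup>m\<close>, and the claim becomes
  \<open>\<Sum> w\<^sub>i w\<^sub>j \<bar>\<langle>x\<^sub>i, x\<^sub>j\<rangle>\<bar> \<le> C\<close>. This follows from an even quartic majorant of \<open>\<bar>t\<bar>\<close> on \<open>[-1, 1]\<close> that
  touches at \<open>\<plusminus>\<alpha>\<close> and \<open>\<plusminus>1\<close>, together with the lower bound for fourth moments.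

  Lower bound. If \<open>\<real>\<^sup>m\<close> contains \<open>N = m (m + 1) / 2\<close> equiangular lines with cosine \<open>\<alpha>\<close>, they form a tight
  frame, and averaging any projection of \<open>\<ell>\<^sub>\<infinity>\<close> onto the range of the Gram matrix against its sign matrix
  shows that the norm is at least \<open>C\<close>. Such lines are the diagonals of the regular hexagon and of the
  icosahedron, the 28 lines in \<open>\<real>\<^sup>7\<close> and the 276 lines in \<open>\<real>\<^sup>2\<^sup>3\<close>.
\<close>

section \<open>Mean absolute inner products of isotropic systems\<close>

text \<open>For \<open>s = \<bar>t\<bar>\<close> the gap times the denominator is
  \<open>(s - al)^2 * (1 - s) * (s + 1 + 2*al)\<close>. The last factor is forced: the quartic has
  no cubic term, so its roots \<open>al\<close>, \<open>al\<close>, \<open>1\<close> and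
  \<open>-(1 + 2*al)\<close> sum to zero.\<close>

lemma abs_le_even_quartic:
  fixes al t :: real
  assumes "0 < al" "\<bar>t\<bar> \<le> 1"
  shows "\<bar>t\<bar> \<le> (al\<^sup>2 * (1 + 2*al) + (1 + 2*al + 3*al\<^sup>2) * t\<^sup>2 - t^4) / (2*al*(1+al)\<^sup>2)"
proof -
  define s where "s = \<bar>t\<bar>"
  have s: "0 \<le> s" "s \<le> 1" "t\<^sup>2 = s\<^sup>2" "t^4 = s^4"
    using assms by (auto simp: s_def power_even_abs)
  have "0 \<le> (s - al)\<^sup>2 * ((1 - s) * (s + 1 + 2*al))"
    using s assms by (intro mult_nonneg_nonneg) auto
  also have "\<dots> = al\<^sup>2 * (1 + 2*al) + (1 + 2*al + 3*al\<^sup>2) * s\<^sup>2 - s^4 - s * (2*al*(1+al)\<^sup>2)"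
    by (simp add: power2_eq_square power4_eq_xxxx algebra_simps)
  finally have "s * (2*al*(1+al)\<^sup>2) \<le> al\<^sup>2 * (1 + 2*al) + (1 + 2*al + 3*al\<^sup>2) * s\<^sup>2 - s^4" by simp
  moreover have "0 < 2*al*(1+al)\<^sup>2" using assms by simp
  ultimately show ?thesis
    unfolding s s_def[symmetric] by (simp add: pos_le_divide_eq)
qed


section \<open>Fourth moment tensors\<close>

lemma sum_of_bool_image:
  fixes T :: "'a \<Rightarrow> real"
  assumes "finite Q" "inj_on h S" "h ` S = {q\<in>Q. P q}"
  shows "(\<Sum>q\<in>Q. T q * of_bool (P q)) = (\<Sum>p\<in>S. T (h p))"
proof -
  have "(\<Sum>q\<in>Q. T q * of_bool (P q)) = (\<Sum>q\<in>Q. if P q then T q else 0)"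
    by (intro sum.cong refl) auto
  also have "\<dots> = (\<Sum>q\<in>{q\<in>Q. P q}. T q)"
    by (rule sum.inter_filter[OF assms(1), symmetric])
  also have "\<dots> = (\<Sum>p\<in>S. T (h p))"
    using assms(2) by (simp add: assms(3)[symmetric] sum.reindex)
  finally show ?thesis .
qed

text \<open>Pairing the fourth moment tensor with the symmetrised square of the identity bounds its norm.\<close>

definition sym_tensor4 :: "nat \<times> nat \<times> nat \<times> nat \<Rightarrow> real" where
  "sym_tensor4 = (\<lambda>(a,b,c,d). of_bool (a = b \<and> c = d) + of_bool (a = c \<and> b = d)
                             + of_bool (a = d \<and> b = c))"

lemma sum_sym_tensor4:
  fixes T :: "nat \<times> nat \<times> nat \<times> nat \<Rightarrow> real"
  shows "(\<Sum>q\<in>{..<m} \<times> {..<m} \<times> {..<m} \<times> {..<m}. T q * sym_tensor4 q)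
       = (\<Sum>a<m. \<Sum>b<m. T (a,a,b,b) + T (a,b,a,b) + T (a,b,b,a))"
proof -
  let ?Q = "{..<m} \<times> {..<m} \<times> {..<m} \<times> {..<m}"
  have "(\<Sum>q\<in>?Q. T q * sym_tensor4 q) =
      (\<Sum>q\<in>?Q. T q * of_bool (case q of (a,b,c,d) \<Rightarrow> a = b \<and> c = d)) +
      (\<Sum>q\<in>?Q. T q * of_bool (case q of (a,b,c,d) \<Rightarrow> a = c \<and> b = d)) +
      (\<Sum>q\<in>?Q. T q * of_bool (case q of (a,b,c,d) \<Rightarrow> a = d \<and> b = c))"
    unfolding sum.distrib[symmetric] sym_tensor4_def
    by (intro sum.cong refl) (auto simp: algebra_simps)
  also have "(\<Sum>q\<in>?Q. T q * of_bool (case q of (a,b,c,d) \<Rightarrow> a = b \<and> c = d))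
      = (\<Sum>p\<in>{..<m}\<times>{..<m}. T ((\<lambda>(a,b). (a,a,b,b)) p))"
    by (rule sum_of_bool_image) (force simp: inj_on_def)+
  also have "(\<Sum>q\<in>?Q. T q * of_bool (case q of (a,b,c,d) \<Rightarrow> a = c \<and> b = d))
      = (\<Sum>p\<in>{..<m}\<times>{..<m}. T ((\<lambda>(a,b). (a,b,a,b)) p))"
    by (rule sum_of_bool_image) (force simp: inj_on_def)+
  also have "(\<Sum>q\<in>?Q. T q * of_bool (case q of (a,b,c,d) \<Rightarrow> a = d \<and> b = c))
      = (\<Sum>p\<in>{..<m}\<times>{..<m}. T ((\<lambda>(a,b). (a,b,b,a)) p))"
    by (rule sum_of_bool_image) (force simp: inj_on_def)+
  finally show ?thesis
    by (simp add: sum.cartesian_product sum.distrib split_def)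
qed

lemma sum_square_product:
  fixes f :: "'i \<Rightarrow> 'b \<Rightarrow> real"
  shows "(\<Sum>a\<in>A. (\<Sum>i\<in>I. g i * f i a)\<^sup>2) = (\<Sum>i\<in>I. \<Sum>j\<in>I. g i * g j * (\<Sum>a\<in>A. f i a * f j a))"
proof -
  have "(\<Sum>a\<in>A. (\<Sum>i\<in>I. g i * f i a)\<^sup>2) = (\<Sum>a\<in>A. \<Sum>i\<in>I. \<Sum>j\<in>I. g i * g j * (f i a * f j a))"
    by (simp add: power2_eq_square sum_product mult_ac)
  also have "\<dots> = (\<Sum>i\<in>I. \<Sum>a\<in>A. \<Sum>j\<in>I. g i * g j * (f i a * f j a))"
    by (rule sum.swap)
  also have "\<dots> = (\<Sum>i\<in>I. \<Sum>j\<in>I. \<Sum>a\<in>A. g i * g j * (f i a * f j a))"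
    by (intro sum.cong refl sum.swap)
  finally show ?thesis by (simp add: sum_distrib_left)
qed

text \<open>Cauchy-Schwarz for the tensor \<open>M\<close>, the sum of \<open>g i\<close> times the
  fourth tensor power of \<open>u i\<close>, against \<open>sym_tensor4\<close>. Inner products of
  fourth tensor powers are fourth powers of inner products, and pairing the fourth power of
  \<open>u i\<close> with \<open>sym_tensor4\<close> gives three times the fourth power of its
  length.\<close>

lemma fourth_moment_lower_bound:
  fixes u :: "'i \<Rightarrow> nat \<Rightarrow> real"
  shows "3 * (\<Sum>i\<in>I. g i * (\<Sum>a<m. (u i a)\<^sup>2)\<^sup>2)\<^sup>2
    \<le> real m * (real m + 2) * (\<Sum>i\<in>I. \<Sum>j\<in>I. g i * g j * (\<Sum>a<m. u i a * u j a)^4)"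
proof -
  let ?Q = "{..<m} \<times> {..<m} \<times> {..<m} \<times> {..<m}"
  define f where "f i = (\<lambda>(a,b,c,d). u i a * u i b * u i c * u i d)" for i
  define M where "M q = (\<Sum>i\<in>I. g i * f i q)" for q
  have MM: "(\<Sum>q\<in>?Q. (M q)\<^sup>2) = (\<Sum>i\<in>I. \<Sum>j\<in>I. g i * g j * (\<Sum>a<m. u i a * u j a)^4)"
  proof -
    have "(\<Sum>q\<in>?Q. f i q * f j q) = (\<Sum>a<m. u i a * u j a)^4" for i j
    proof -
      have p4: "y^4 = y * (y * (y * y))" for y :: real by (simp add: power4_eq_xxxx mult.assoc)
      show ?thesis
        unfolding p4 sum_product sum.cartesian_product
        by (intro sum.cong refl) (auto simp: f_def mult_ac)
    qed
    then show ?thesis unfolding M_def sum_square_product by simp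
  qed
  have SS: "(\<Sum>q\<in>?Q. (sym_tensor4 q)\<^sup>2) = 3 * (real m * (real m + 2))"
  proof -
    have d: "(\<Sum>a<m. \<Sum>b<m. of_bool (a = b)) = real m"
      by (simp add: of_bool_def)
    \<comment> \<open>Each of the three pairings gives 1 when \<open>a \<noteq> b\<close>; when
      \<open>a = b\<close> all three terms of \<open>sym_tensor4\<close> coincide and the total is
      9.\<close>
    have "(\<Sum>q\<in>?Q. (sym_tensor4 q)\<^sup>2) = (\<Sum>a<m. \<Sum>b<m. 3 + 6 * of_bool (a = b))"
      unfolding power2_eq_square sum_sym_tensor4
      by (intro sum.cong refl) (auto simp: sym_tensor4_def)
    also have "\<dots> = 3 * (real m * real m) + 6 * real m"
      using d by (simp add: sum.distrib sum_distrib_left[symmetric] algebra_simps)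
    finally show ?thesis by (simp add: algebra_simps)
  qed
  have MS: "(\<Sum>q\<in>?Q. M q * sym_tensor4 q) = 3 * (\<Sum>i\<in>I. g i * (\<Sum>a<m. (u i a)\<^sup>2)\<^sup>2)"
  proof -
    have fS: "(\<Sum>q\<in>?Q. f i q * sym_tensor4 q) = 3 * (\<Sum>a<m. (u i a)\<^sup>2)\<^sup>2" for i
    proof -
      have "(\<Sum>a<m. (u i a)\<^sup>2)\<^sup>2 = (\<Sum>a<m. \<Sum>b<m. (u i a)\<^sup>2 * (u i b)\<^sup>2)"
        by (simp only: power2_eq_square[of "sum _ _"] sum_product)
      then show ?thesis
        unfolding sum_sym_tensor4
        by (simp only: sum_distrib_left) (intro sum.cong refl, auto simp: f_def power2_eq_square)
    qed
    have "(\<Sum>q\<in>?Q. M q * sym_tensor4 q) = (\<Sum>q\<in>?Q. \<Sum>i\<in>I. g i * (f i q * sym_tensor4 q))"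
      by (simp add: M_def sum_distrib_right mult.assoc)
    also have "\<dots> = (\<Sum>i\<in>I. g i * (\<Sum>q\<in>?Q. f i q * sym_tensor4 q))"
      by (subst sum.swap) (simp add: sum_distrib_left)
    also have "\<dots> = (\<Sum>i\<in>I. g i * (3 * (\<Sum>a<m. (u i a)\<^sup>2)\<^sup>2))" by (simp only: fS)
    finally show ?thesis by (simp add: sum_distrib_left mult_ac)
  qed
  have "(\<Sum>q\<in>?Q. M q * sym_tensor4 q)\<^sup>2 \<le> (\<Sum>q\<in>?Q. (M q)\<^sup>2) * (\<Sum>q\<in>?Q. (sym_tensor4 q)\<^sup>2)"
    by (rule Cauchy_Schwarz_ineq_sum)
  moreover have "3 * X\<^sup>2 \<le> Z * Y" if "(3 * X)\<^sup>2 \<le> Y * (3 * Z)" for X Y Z :: real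
    using that by (simp add: power2_eq_square algebra_simps)
  ultimately show ?thesis unfolding MM SS MS by blast
qed

text \<open>The coefficients of the majorant are chosen so that equality holds on equiangular lines, where
  \<open>\<bar>t\<bar>\<close> only takes the values \<open>al\<close> and 1. Applied to the normalised vectors with weights \<open>r i * r j\<close>, its
  quadratic part is controlled by isotropy, since \<open>r i * r j \<le> ((r i)\<^sup>2 + (r j)\<^sup>2) / 2\<close>.\<close>

theorem isotropic_mean_abs_inner_le:
  fixes w :: "'i \<Rightarrow> real" and x :: "'i \<Rightarrow> nat \<Rightarrow> real"
  assumes w: "\<And>i. i \<in> I \<Longrightarrow> 0 \<le> w i" "sum w I = 1"
    and iso: "\<And>a b. a < m \<Longrightarrow> b < m \<Longrightarrow> (\<Sum>i\<in>I. w i * (x i a * x i b)) = of_bool (a = b)"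
    and al: "0 < al" "al\<^sup>2 * (real m + 2) = 1" and m: "2 \<le> m"
  shows "(\<Sum>i\<in>I. \<Sum>j\<in>I. w i * w j * \<bar>\<Sum>a<m. x i a * x j a\<bar>) \<le> (1 - al) * (1 + 2*al) / (al * (1 + al))"
proof -
  define r where "r i = sqrt (\<Sum>a<m. (x i a)\<^sup>2)" for i
  \<comment> \<open>Division by zero makes \<open>u i\<close> vanish when \<open>r i = 0\<close>;
    otherwise it is a unit vector.\<close>
  define u where "u i a = x i a / r i" for i a
  define t where "t i j = (\<Sum>a<m. u i a * u j a)" for i j
  have r0: "0 \<le> r i" for i by (simp add: r_def sum_nonneg)
  have r2: "(r i)\<^sup>2 = (\<Sum>a<m. (x i a)\<^sup>2)" for i by (simp add: r_def sum_nonneg)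
  have xu: "x i a = r i * u i a" if "a < m" for i a
  proof (cases "r i = 0")
    case True
    then have "(\<Sum>a<m. (x i a)\<^sup>2) = 0" using r2[of i] by simp
    then show ?thesis using that True by (simp add: sum_nonneg_eq_0_iff)
  qed (simp add: u_def)
  have u2: "(\<Sum>a<m. (u i a)\<^sup>2) = of_bool (r i \<noteq> 0)" for i
    by (simp add: u_def power_divide sum_divide_distrib[symmetric] r2[symmetric])
  have t1: "\<bar>t i j\<bar> \<le> 1" for i j
  proof -
    have "(t i j)\<^sup>2 \<le> (\<Sum>a<m. (u i a)\<^sup>2) * (\<Sum>a<m. (u j a)\<^sup>2)"
      unfolding t_def by (rule Cauchy_Schwarz_ineq_sum)
    also have "\<dots> \<le> 1" by (simp add: u2)
    finally show ?thesis by (simp add: abs_square_le_1)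
  qed
  have tsym: "t i j = t j i" for i j by (simp add: t_def mult.commute)
  have G: "(\<Sum>a<m. x i a * x j a) = r i * r j * t i j" for i j
    unfolding t_def sum_distrib_left by (intro sum.cong refl) (simp add: xu)
  \<comment> \<open>Isotropy in the form of a Parseval identity.\<close>
  have iso_quad: "(\<Sum>j\<in>I. w j * (\<Sum>a<m. y a * x j a)\<^sup>2) = (\<Sum>a<m. (y a)\<^sup>2)" for y
  proof -
    have "(\<Sum>j\<in>I. w j * (\<Sum>a<m. y a * x j a)\<^sup>2)
        = (\<Sum>j\<in>I. \<Sum>a<m. \<Sum>b<m. y a * y b * (w j * (x j a * x j b)))"
      by (simp add: power2_eq_square sum_product sum_distrib_left mult_ac)
    also have "\<dots> = (\<Sum>a<m. \<Sum>j\<in>I. \<Sum>b<m. y a * y b * (w j * (x j a * x j b)))"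
      by (rule sum.swap)
    also have "\<dots> = (\<Sum>a<m. \<Sum>b<m. \<Sum>j\<in>I. y a * y b * (w j * (x j a * x j b)))"
      by (intro sum.cong refl sum.swap)
    also have "\<dots> = (\<Sum>a<m. \<Sum>b<m. y a * y b * of_bool (a = b))"
      by (simp add: sum_distrib_left[symmetric] iso)
    also have "\<dots> = (\<Sum>a<m. (y a)\<^sup>2)"
      by (simp add: of_bool_def power2_eq_square if_distrib cong: if_cong)
    finally show ?thesis .
  qed
  have wr2: "(\<Sum>i\<in>I. w i * (r i)\<^sup>2) = real m"
  proof -
    have "(\<Sum>i\<in>I. w i * (r i)\<^sup>2) = (\<Sum>i\<in>I. \<Sum>a<m. w i * (x i a * x i a))"
      unfolding r2 by (simp add: sum_distrib_left power2_eq_square)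
    also have "\<dots> = (\<Sum>a<m. \<Sum>i\<in>I. w i * (x i a * x i a))" by (rule sum.swap)
    finally show ?thesis by (simp add: iso)
  qed
  define R where "R = (\<Sum>i\<in>I. w i * r i)"
  have RR: "(\<Sum>i\<in>I. \<Sum>j\<in>I. w i * w j * (r i * r j)) = R\<^sup>2"
    by (simp add: R_def power2_eq_square sum_product mult_ac)
  have Rm: "R\<^sup>2 \<le> real m"
  proof -
    \<comment> \<open>Cauchy-Schwarz with the weights split into square roots; the first factor is
      \<open>sum w I = 1\<close>.\<close>
    have "R = (\<Sum>i\<in>I. sqrt (w i) * (sqrt (w i) * r i))"
      unfolding R_def by (intro sum.cong refl) (simp add: w mult.assoc[symmetric])
    then have "R\<^sup>2 \<le> (\<Sum>i\<in>I. (sqrt (w i))\<^sup>2) * (\<Sum>i\<in>I. (sqrt (w i) * r i)\<^sup>2)"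
      using Cauchy_Schwarz_ineq_sum by metis
    also have "\<dots> = real m" using w wr2 by (simp add: power_mult_distrib)
    finally show ?thesis .
  qed
  define S2 where "S2 = (\<Sum>i\<in>I. \<Sum>j\<in>I. w i * w j * (r i * r j * (t i j)\<^sup>2))"
  have S2: "S2 \<le> 1"
  proof -
    have *: "(\<Sum>i\<in>I. \<Sum>j\<in>I. w i * w j * ((r j)\<^sup>2 * (t i j)\<^sup>2)) \<le> 1"
    proof -
      \<comment> \<open>\<open>r j * t i j\<close> is the inner product of \<open>u i\<close> and
        \<open>x j\<close>, so Parseval evaluates the sum over \<open>j\<close> as the squared
        length of \<open>u i\<close>, which is at most 1.\<close>
      have "(\<Sum>i\<in>I. \<Sum>j\<in>I. w i * w j * ((r j)\<^sup>2 * (t i j)\<^sup>2))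
          = (\<Sum>i\<in>I. w i * (\<Sum>j\<in>I. w j * (\<Sum>a<m. u i a * x j a)\<^sup>2))"
        by (simp add: sum_distrib_left t_def xu power_mult_distrib[symmetric] mult_ac)
      also have "\<dots> \<le> (\<Sum>i\<in>I. w i * 1)"
        by (intro sum_mono mult_left_mono) (simp_all add: iso_quad u2 w)
      finally show ?thesis using w by simp
    qed
    have **: "(\<Sum>i\<in>I. \<Sum>j\<in>I. w i * w j * ((r i)\<^sup>2 * (t i j)\<^sup>2)) \<le> 1"
      using * by (subst sum.swap) (simp add: tsym[of _ _] mult_ac tsym)
    have "S2 \<le> (\<Sum>i\<in>I. \<Sum>j\<in>I. (w i * w j * ((r i)\<^sup>2 * (t i j)\<^sup>2) + w i * w j * ((r j)\<^sup>2 * (t i j)\<^sup>2)) / 2)"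
      unfolding S2_def
    proof (intro sum_mono)
      fix i j assume ij: "i \<in> I" "j \<in> I"
      have "r i * r j \<le> ((r i)\<^sup>2 + (r j)\<^sup>2) / 2"
        using sum_squares_bound[of "r i" "r j"] by simp
      then have "w i * w j * (t i j)\<^sup>2 * (r i * r j) \<le> w i * w j * (t i j)\<^sup>2 * (((r i)\<^sup>2 + (r j)\<^sup>2) / 2)"
        using w ij by (intro mult_left_mono) auto
      then show "w i * w j * (r i * r j * (t i j)\<^sup>2)
          \<le> (w i * w j * ((r i)\<^sup>2 * (t i j)\<^sup>2) + w i * w j * ((r j)\<^sup>2 * (t i j)\<^sup>2)) / 2"
        by (simp add: algebra_simps)
    qed
    also have "\<dots> \<le> 1"
      using * ** by (simp add: sum_divide_distrib[symmetric] sum.distrib)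
    finally show ?thesis .
  qed
  define S4 where "S4 = (\<Sum>i\<in>I. \<Sum>j\<in>I. w i * w j * (r i * r j * (t i j)^4))"
  have S4: "3 * R\<^sup>2 \<le> real m * (real m + 2) * S4"
  proof -
    \<comment> \<open>The fourth moment bound is applied with \<open>g i = w i * r i\<close>. The
      inserted factor is 1 unless \<open>r i = 0\<close>, where the term vanishes anyway.\<close>
    have Req: "R = (\<Sum>i\<in>I. (w i * r i) * (\<Sum>a<m. (u i a)\<^sup>2)\<^sup>2)"
      unfolding R_def u2 by (intro sum.cong refl) simp
    have S4eq: "S4 = (\<Sum>i\<in>I. \<Sum>j\<in>I. (w i * r i) * (w j * r j) * (\<Sum>a<m. u i a * u j a)^4)"
      by (simp add: S4_def t_def mult_ac)
    show ?thesis unfolding Req S4eq by (rule fourth_moment_lower_bound)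
  qed
  define c where "c = 1 / (2*al*(1+al)\<^sup>2)"
  have c: "0 < c" using al by (simp add: c_def)
  have "(\<Sum>i\<in>I. \<Sum>j\<in>I. w i * w j * \<bar>\<Sum>a<m. x i a * x j a\<bar>)
     \<le> (\<Sum>i\<in>I. \<Sum>j\<in>I. c * (al\<^sup>2 * (1 + 2*al) * (w i * w j * (r i * r j))
          + (1 + 2*al + 3*al\<^sup>2) * (w i * w j * (r i * r j * (t i j)\<^sup>2))
          - w i * w j * (r i * r j * (t i j)^4)))"
  proof (intro sum_mono)
    fix i j assume ij: "i \<in> I" "j \<in> I"
    have "w i * w j * \<bar>\<Sum>a<m. x i a * x j a\<bar> = w i * w j * (r i * r j) * \<bar>t i j\<bar>"
      by (simp add: G abs_mult r0)
    also have "\<dots> \<le> w i * w j * (r i * r j) *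
       ((al\<^sup>2 * (1 + 2*al) + (1 + 2*al + 3*al\<^sup>2) * (t i j)\<^sup>2 - (t i j)^4) / (2*al*(1+al)\<^sup>2))"
      using abs_le_even_quartic[OF al(1) t1] ij w r0 by (intro mult_left_mono) auto
    also have "\<dots> = c * (al\<^sup>2 * (1 + 2*al) * (w i * w j * (r i * r j))
          + (1 + 2*al + 3*al\<^sup>2) * (w i * w j * (r i * r j * (t i j)\<^sup>2))
          - w i * w j * (r i * r j * (t i j)^4))"
      unfolding c_def by (simp add: field_simps)
    finally show "w i * w j * \<bar>\<Sum>a<m. x i a * x j a\<bar> \<le> \<dots>" .
  qed
  also have "\<dots> = c * (al\<^sup>2 * (1 + 2*al) * R\<^sup>2 + (1 + 2*al + 3*al\<^sup>2) * S2 - S4)"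
    unfolding RR[symmetric] S2_def S4_def
    by (simp add: sum_distrib_left[symmetric] sum.distrib sum_subtractf)
  also have "\<dots> \<le> c * (al\<^sup>2 * (1 + 2*al) * real m + (1 + 2*al + 3*al\<^sup>2) - 3 * al\<^sup>2)"
  proof -
    have m0: "0 < real m" using m by simp
    have m2: "real m + 2 = 1 / al\<^sup>2" using al by (simp add: field_simps)
    have S4': "3 * al\<^sup>2 * R\<^sup>2 \<le> real m * S4"
      using S4 al unfolding m2 by (simp add: field_simps)
    \<comment> \<open>Once \<open>S4\<close> is eliminated, this is the sign of the coefficient of
      \<open>R^2\<close> that allows \<open>Rm\<close> to be inserted. For \<open>m = 2\<close> it
      comes from \<open>al = 1/2\<close>; from 3 on the size of \<open>m\<close> gives it.\<close>
    have pos: "0 \<le> real m * (1 + 2*al) - 3"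
    proof (cases "m = 2")
      case True
      then have "(2*al)\<^sup>2 = 1\<^sup>2" using al by (simp add: power_mult_distrib)
      then have "2*al = 1" using al by (subst (asm) power2_eq_iff_nonneg) auto
      then show ?thesis using True by simp
    next
      case False
      then have "3 * 1 \<le> real m * (1 + 2*al)" using m al by (intro mult_mono) auto
      then show ?thesis by simp
    qed
    have "real m * (al\<^sup>2 * (1 + 2*al) * R\<^sup>2 - S4) \<le> al\<^sup>2 * (real m * (1 + 2*al) - 3) * R\<^sup>2"
      using S4' by (simp add: algebra_simps)
    also have "\<dots> \<le> al\<^sup>2 * (real m * (1 + 2*al) - 3) * real m"
      using pos by (intro mult_left_mono Rm mult_nonneg_nonneg) auto
    also have "\<dots> = real m * (al\<^sup>2 * (1 + 2*al) * real m - 3 * al\<^sup>2)" by (simp add: algebra_simps)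
    finally have "al\<^sup>2 * (1 + 2*al) * R\<^sup>2 - S4 \<le> al\<^sup>2 * (1 + 2*al) * real m - 3 * al\<^sup>2"
      using m0 by (simp only: mult_le_cancel_left_pos)
    moreover have "(1 + 2*al + 3*al\<^sup>2) * S2 \<le> (1 + 2*al + 3*al\<^sup>2) * 1"
      using al S2 by (intro mult_left_mono) auto
    ultimately show ?thesis using c by (intro mult_left_mono) auto
  qed
  also have "\<dots> = c * (2 * (1 + 2*al) * (1 - al) * (1 + al))"
  proof -
    have "al\<^sup>2 * real m = 1 - 2 * al\<^sup>2" using al by (simp add: algebra_simps)
    then have "al\<^sup>2 * (1 + 2*al) * real m = (1 + 2*al) * (1 - 2 * al\<^sup>2)"
      by (metis mult.assoc mult.commute)
    then have "al\<^sup>2 * (1 + 2*al) * real m + (1 + 2*al + 3*al\<^sup>2) - 3 * al\<^sup>2 = 2 * (1 + 2*al) * (1 - al) * (1 + al)"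
      by (simp add: algebra_simps power2_eq_square)
    then show ?thesis by simp
  qed
  also have "\<dots> = (1 - al) * (1 + 2*al) / (al * (1 + al))"
    using al unfolding c_def by (simp add: divide_simps power2_eq_square)
  finally show ?thesis .
qed

section \<open>A minimax lemma and orthonormal bases\<close>

text \<open>Best responses to the weights proportional to the excesses \<open>max 0 (v k - c)\<close> decrease the sum of
  the squared excesses, so that its infimum over \<open>V\<close> vanishes.\<close>

lemma approx_minimax:
  fixes V :: "('k \<Rightarrow> real) set"
  assumes K: "finite K" "K \<noteq> {}"
    and conv: "\<And>v v' s. v \<in> V \<Longrightarrow> v' \<in> V \<Longrightarrow> 0 \<le> s \<Longrightarrow> s \<le> 1 \<Longrightarrow>
                 \<exists>v''\<in>V. \<forall>k\<in>K. v'' k \<le> (1 - s) * v k + s * v' k"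
    and resp: "\<And>w. (\<forall>k\<in>K. 0 \<le> w k) \<Longrightarrow> sum w K = 1 \<Longrightarrow>
                 \<exists>v\<in>V. (\<Sum>k\<in>K. w k * v k) \<le> c \<and> (\<forall>k\<in>K. \<bar>v k\<bar> \<le> M)"
    and e: "0 < e"
  shows "\<exists>v\<in>V. \<forall>k\<in>K. v k \<le> c + e"
proof -
  define phi where "phi v = (\<Sum>k\<in>K. (max 0 (v k - c))\<^sup>2)" for v
  define D where "D = Inf (phi ` V)"
  have phi0: "0 \<le> phi v" for v by (simp add: phi_def sum_nonneg)
  have bdd: "bdd_below (phi ` V)" using phi0 by (intro bdd_belowI[of _ 0]) auto
  have Dle: "D \<le> phi v" if "v \<in> V" for v
    unfolding D_def using that bdd by (intro cInf_lower) auto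
  obtain v0 where "v0 \<in> V"
  proof -
    have "\<exists>v\<in>V. (\<Sum>k\<in>K. (1 / real (card K)) * v k) \<le> c \<and> (\<forall>k\<in>K. \<bar>v k\<bar> \<le> M)"
      using K by (intro resp) auto
    then show ?thesis using that by blast
  qed
  then have ne: "phi ` V \<noteq> {}" by blast
  have near: "\<exists>v\<in>V. phi v < D + h" if "0 < h" for h
    using cInf_lessD[OF ne, of "D + h"] that by (auto simp: D_def)
  have "D \<le> 0"
  proof (rule ccontr)
    assume "\<not> D \<le> 0"
    then have D: "0 < D" by simp
    \<comment> \<open>\<open>L\<close> bounds the second-order error, and adding \<open>D\<close>
      makes \<open>s \<le> 1/2\<close>. With \<open>s * L = D / 2\<close> that error is half of
      \<open>s * D\<close>, a lower bound for the first-order gain.\<close>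
    define L where "L = (\<Sum>k\<in>K. (M + \<bar>c\<bar>)\<^sup>2) + D"
    have L: "D \<le> L" by (simp add: L_def sum_nonneg)
    define s where "s = D / (2 * L)"
    have s: "0 < s" "s \<le> 1" "s * L = D / 2"
      using D L by (auto simp: s_def field_simps)
    \<comment> \<open>The slack \<open>s * D / 2\<close> uses up the other half of the gain, so that
      the step to \<open>v''\<close> falls below the infimum.\<close>
    obtain v where v: "v \<in> V" "phi v < D + s * D / 2"
      using near[of "s * D / 2"] s D by auto
    define a where "a k = max 0 (v k - c)" for k
    have a0: "0 \<le> a k" for k by (simp add: a_def)
    have P: "0 < sum a K"
    proof (rule ccontr)
      assume "\<not> 0 < sum a K"
      then have "sum a K = 0" using sum_nonneg[of K a] a0 by simp
      then have "\<forall>k\<in>K. a k = 0" using K a0 by (simp add: sum_nonneg_eq_0_iff)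
      then have "phi v = 0" by (simp add: phi_def a_def)
      then show False using Dle[OF v(1)] D by simp
    qed
    obtain v' where v': "v' \<in> V" "(\<Sum>k\<in>K. a k / sum a K * v' k) \<le> c" "\<forall>k\<in>K. \<bar>v' k\<bar> \<le> M"
    proof -
      have "\<exists>v'\<in>V. (\<Sum>k\<in>K. a k / sum a K * v' k) \<le> c \<and> (\<forall>k\<in>K. \<bar>v' k\<bar> \<le> M)"
        using P a0 by (intro resp) (auto simp: sum_divide_distrib[symmetric])
      then show ?thesis using that by blast
    qed
    \<comment> \<open>The response is at most \<open>c\<close> on average for weights proportional
      to the excesses, so the mixed term can only help.\<close>
    have cross: "(\<Sum>k\<in>K. a k * (v' k - c)) \<le> 0"
    proof -
      have "(\<Sum>k\<in>K. a k * v' k) / sum a K \<le> c" using v'(2) by (simp add: sum_divide_distrib)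
      then have "(\<Sum>k\<in>K. a k * v' k) \<le> c * sum a K" using P by (simp add: pos_divide_le_eq)
      then show ?thesis by (simp add: right_diff_distrib sum_subtractf sum_distrib_left mult.commute)
    qed
    obtain v'' where v'': "v'' \<in> V" "\<forall>k\<in>K. v'' k \<le> (1 - s) * v k + s * v' k"
      using conv[OF v(1) v'(1) less_imp_le[OF s(1)] s(2)] by blast
    have "phi v'' \<le> (\<Sum>k\<in>K. (1-s)\<^sup>2 * (a k)\<^sup>2 + 2 * s * (1-s) * (a k * (v' k - c)) + s\<^sup>2 * (M + \<bar>c\<bar>)\<^sup>2)"
      unfolding phi_def
    proof (rule sum_mono)
      fix k assume k: "k \<in> K"
      have "v'' k - c \<le> (1 - s) * (v k - c) + s * (v' k - c)"
        using v''(2) k by (auto simp: algebra_simps)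
      also have "\<dots> \<le> (1 - s) * a k + s * (v' k - c)"
        using s by (intro add_right_mono mult_left_mono) (auto simp: a_def)
      finally have le: "v'' k - c \<le> (1 - s) * a k + s * (v' k - c)" .
      have "(max 0 (v'' k - c))\<^sup>2 \<le> ((1 - s) * a k + s * (v' k - c))\<^sup>2"
      proof (cases "v'' k - c \<le> 0")
        case False
        then show ?thesis using le by (intro power_mono) auto
      qed simp
      also have "\<dots> = (1-s)\<^sup>2 * (a k)\<^sup>2 + 2 * s * (1-s) * (a k * (v' k - c)) + s\<^sup>2 * (v' k - c)\<^sup>2"
        by (simp add: power2_eq_square algebra_simps)
      also have "(v' k - c)\<^sup>2 \<le> (M + \<bar>c\<bar>)\<^sup>2"
      proof -
        have "\<bar>v' k - c\<bar> \<le> M + \<bar>c\<bar>" using v'(3) k by force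
        then show ?thesis by (metis abs_ge_zero power2_abs power_mono)
      qed
      finally show "(max 0 (v'' k - c))\<^sup>2 \<le>
         (1-s)\<^sup>2 * (a k)\<^sup>2 + 2 * s * (1-s) * (a k * (v' k - c)) + s\<^sup>2 * (M + \<bar>c\<bar>)\<^sup>2"
        by (simp add: mult_left_mono)
    qed
    also have "\<dots> = (1-s)\<^sup>2 * phi v + 2 * s * (1-s) * (\<Sum>k\<in>K. a k * (v' k - c)) + s\<^sup>2 * (\<Sum>k\<in>K. (M + \<bar>c\<bar>)\<^sup>2)"
      unfolding phi_def a_def[symmetric] by (simp only: sum.distrib sum_distrib_left)
    also have "\<dots> \<le> (1-s) * phi v + s\<^sup>2 * L"
    proof -
      have "(1-s)\<^sup>2 * phi v \<le> (1-s) * phi v"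
        using s phi0 by (intro mult_right_mono) (auto simp: power2_eq_square mult_left_le)
      moreover have "2 * s * (1-s) * (\<Sum>k\<in>K. a k * (v' k - c)) \<le> 0"
        using s cross by (intro mult_nonneg_nonpos) auto
      moreover have "s\<^sup>2 * (\<Sum>k\<in>K. (M + \<bar>c\<bar>)\<^sup>2) \<le> s\<^sup>2 * L"
        using D by (intro mult_left_mono) (auto simp: L_def)
      ultimately show ?thesis by linarith
    qed
    also have "\<dots> = phi v - s * phi v + s * (D / 2)"
      using s(3) by (simp add: power2_eq_square algebra_simps)
    also have "\<dots> < D"
    proof -
      have "s * D \<le> s * phi v" using Dle[OF v(1)] s by (intro mult_left_mono) auto
      then show ?thesis using v(2) by simp
    qed
    finally show False using Dle[OF v''(1)] by simp
  qed
  then obtain v where v: "v \<in> V" "phi v < e\<^sup>2"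
    using near[of "e\<^sup>2"] e by force
  have "v k \<le> c + e" if "k \<in> K" for k
  proof -
    have "(max 0 (v k - c))\<^sup>2 \<le> phi v"
      unfolding phi_def using K that by (intro member_le_sum) auto
    then have "(max 0 (v k - c))\<^sup>2 < e\<^sup>2" using v by simp
    then have "max 0 (v k - c) < e" using e by (meson power_less_imp_less_base less_imp_le)
    then show ?thesis by simp
  qed
  then show ?thesis using v by blast
qed

text \<open>Gram-Schmidt, by induction on \<open>S\<close>, for a form that is definite on
  \<open>span S\<close>. The last clause, the Fourier expansion, is carried along because the step
  uses it to see that \<open>t\<close> is orthogonal to all of the previous span.\<close>

lemma orthonormal_basis_exists:
  fixes B :: "'a::real_vector \<Rightarrow> 'a \<Rightarrow> real"
  assumes lin: "\<And>x. linear (B x)" and sym: "\<And>x y. B x y = B y x"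
    and "finite S" "independent S" "\<And>x. x \<in> span S \<Longrightarrow> x \<noteq> 0 \<Longrightarrow> 0 < B x x"
  shows "\<exists>e. (\<forall>a<card S. e a \<in> span S) \<and>
             (\<forall>a<card S. \<forall>b<card S. B (e a) (e b) = of_bool (a = b)) \<and>
             (\<forall>y\<in>span S. (\<Sum>a<card S. B (e a) y *\<^sub>R e a) = y)"
  using assms(3-)
proof (induction S)
  case empty
  then show ?case by auto
next
  case (insert s S)
  let ?n = "card S"
  have sub: "span S \<subseteq> span (insert s S)" by (simp add: span_mono subset_insertI)
  have "\<exists>e. (\<forall>a<?n. e a \<in> span S) \<and> (\<forall>a<?n. \<forall>b<?n. B (e a) (e b) = of_bool (a = b)) \<and>
             (\<forall>y\<in>span S. (\<Sum>a<?n. B (e a) y *\<^sub>R e a) = y)"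
    using insert.prems sub by (intro insert.IH) (auto simp: independent_insert split: if_splits)
  then obtain e where e: "\<And>a. a < ?n \<Longrightarrow> e a \<in> span S"
    "\<And>a b. a < ?n \<Longrightarrow> b < ?n \<Longrightarrow> B (e a) (e b) = of_bool (a = b)"
    "\<And>y. y \<in> span S \<Longrightarrow> (\<Sum>a<?n. B (e a) y *\<^sub>R e a) = y" by metis
  note Bs = linear_add[OF lin] linear_diff[OF lin] linear_cmul[OF lin] linear_sum[OF lin] linear_0[OF lin]
  define p where "p = (\<Sum>a<?n. B (e a) s *\<^sub>R e a)"
  define t where "t = s - p"
  have p: "p \<in> span S" unfolding p_def using e by (intro span_sum span_scale) auto
  have sS: "s \<notin> span S" using insert by (simp add: independent_insert)
  have t0: "t \<noteq> 0" using p sS by (auto simp: t_def)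
  have tin: "t \<in> span (insert s S)"
    unfolding t_def using p sub by (intro span_diff) (auto intro: span_base)
  have Bt: "0 < B t t" using insert.prems(2) t0 tin by blast
  have et: "B (e b) t = 0" if "b < ?n" for b
  proof -
    have "B (e b) p = (\<Sum>a<?n. B (e a) s * of_bool (b = a))"
      unfolding p_def Bs using e(2) that by (intro sum.cong refl) simp
    also have "\<dots> = B (e b) s" using that by (simp add: of_bool_def if_distrib cong: if_cong)
    finally show ?thesis by (simp add: t_def Bs)
  qed
  have tz: "B t z = 0" if "z \<in> span S" for z
  proof -
    have "B t (\<Sum>a<?n. B (e a) z *\<^sub>R e a) = 0"
      unfolding Bs using et sym by (intro sum.neutral) auto
    then show ?thesis using e(3)[OF that] by simp
  qed
  define q where "q = (1 / sqrt (B t t)) *\<^sub>R t"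
  have qe: "B (e b) q = 0" "B q (e b) = 0" if "b < ?n" for b
    using et[OF that] sym[of q] by (simp_all add: q_def Bs)
  have qq: "B q q = 1"
  proof -
    have "B q q = (1 / sqrt (B t t)) * ((1 / sqrt (B t t)) * B t t)"
      unfolding q_def Bs(3) by (subst sym) (simp add: Bs(3))
    then show ?thesis using Bt by (simp add: real_div_sqrt field_simps)
  qed
  have tq: "t = sqrt (B t t) *\<^sub>R q" using Bt by (simp add: q_def)
  have qin: "q \<in> span (insert s S)" unfolding q_def by (intro span_scale tin)
  define e' where "e' = e(?n := q)"
  have cS: "card (insert s S) = Suc ?n" using insert by simp
  have "(\<Sum>a<Suc ?n. B (e' a) y *\<^sub>R e' a) = y" if y: "y \<in> span (insert s S)" for y
  proof -
    obtain k where k: "y - k *\<^sub>R s \<in> span S" using y span_breakdown_eq by blast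
    \<comment> \<open>Since \<open>s = t + p\<close>, this splits \<open>y\<close> into an element
      of \<open>span S\<close> and a multiple of \<open>t\<close>.\<close>
    define z where "z = y - k *\<^sub>R s + k *\<^sub>R p"
    have z: "z \<in> span S" unfolding z_def using k p by (intro span_add span_scale) auto
    have yz: "y = z + k *\<^sub>R t" by (simp add: z_def t_def algebra_simps)
    have "(\<Sum>a<?n. B (e' a) y *\<^sub>R e' a) = (\<Sum>a<?n. B (e a) z *\<^sub>R e a)"
      using et by (intro sum.cong refl) (simp add: e'_def yz Bs)
    also have "\<dots> = z" by (rule e(3)[OF z])
    finally have 1: "(\<Sum>a<?n. B (e' a) y *\<^sub>R e' a) = z" .
    have "B q z = 0" using tz[OF z] sym[of q z] by (simp add: q_def Bs sym[of z])
    then have "B q y = k * sqrt (B t t)"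
      using qq by (simp add: yz Bs) (subst tq, simp add: Bs)
    then have "B q y *\<^sub>R q = k *\<^sub>R t" by (subst tq) simp
    then show ?thesis using 1 yz by (simp add: e'_def)
  qed
  moreover have "\<forall>a<Suc ?n. e' a \<in> span (insert s S)"
    using e(1) sub qin by (auto simp: e'_def less_Suc_eq)
  moreover have "\<forall>a<Suc ?n. \<forall>b<Suc ?n. B (e' a) (e' b) = of_bool (a = b)"
    using e(2) qe qq by (auto simp: e'_def less_Suc_eq)
  ultimately show ?case unfolding cS by blast
qed

section \<open>Norming functionals\<close>

definition sublinear :: "('a::real_vector \<Rightarrow> real) \<Rightarrow> bool" where
  "sublinear q \<longleftrightarrow> (\<forall>x y. q (x + y) \<le> q x + q y) \<and> (\<forall>t x. 0 \<le> t \<longrightarrow> q (t *\<^sub>R x) = t * q x)"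

lemma sublinear_add: "sublinear q \<Longrightarrow> q (x + y) \<le> q x + q y"
  and sublinear_scale: "sublinear q \<Longrightarrow> 0 \<le> t \<Longrightarrow> q (t *\<^sub>R x) = t * q x"
  by (auto simp: sublinear_def)

lemma sublinear_zero: "sublinear q \<Longrightarrow> q 0 = 0"
  using sublinear_scale[of q 0 0] by simp

lemma sublinear_neg: "sublinear q \<Longrightarrow> - q (- x) \<le> q x"
  using sublinear_add[of q x "-x"] by (simp add: sublinear_zero)

lemma sublinear_norm: "sublinear (norm :: 'a::real_normed_vector \<Rightarrow> real)"
  by (auto simp: sublinear_def norm_triangle_ineq)

text \<open>\<open>q\<close> is lowered along \<open>y\<close> by the infimum of
  \<open>h x t\<close> over \<open>t \<ge> 0\<close>, which is finite because every
  \<open>h x t\<close> is at least \<open>- q (- x)\<close>. Taking \<open>t = 0\<close> gives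
  \<open>p \<le> q\<close>, and \<open>t = 1\<close> at \<open>- y\<close> gives the last
  claim.\<close>

lemma sublinear_tilt:
  fixes q :: "'a::real_vector \<Rightarrow> real"
  assumes q: "sublinear q"
  obtains p where "sublinear p" "\<And>x. p x \<le> q x" "p (- y) \<le> - q y"
proof -
  define h where "h x t = q (x + t *\<^sub>R y) - t * q y" for x t
  define p where "p x = (INF t\<in>{0..}. h x t)" for x
  have low: "- q (- x) \<le> h x t" if "0 \<le> t" for x t
    using sublinear_add[OF q, of "x + t *\<^sub>R y" "- x"] sublinear_scale[OF q that, of y]
    by (simp add: h_def)
  have bdd: "bdd_below (h x ` {0..})" for x
    using low by (intro bdd_belowI[of _ "- q (- x)"]) auto
  have ple: "p x \<le> h x t" if "0 \<le> t" for x t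
    unfolding p_def using that bdd by (intro cINF_lower) auto
  have pge: "b \<le> p x" if "\<And>t. 0 \<le> t \<Longrightarrow> b \<le> h x t" for x b
    unfolding p_def using that by (intro cINF_greatest) auto
  have add: "p (x + x') \<le> p x + p x'" for x x'
  proof -
    have "p (x + x') \<le> h x t + h x' t'" if "0 \<le> t" "0 \<le> t'" for t t'
    proof -
      have "p (x + x') \<le> h (x + x') (t + t')" using that by (intro ple) auto
      also have "\<dots> \<le> h x t + h x' t'"
        using sublinear_add[OF q, of "x + t *\<^sub>R y" "x' + t' *\<^sub>R y"]
        by (simp add: h_def algebra_simps)
      finally show ?thesis .
    qed
    then have "p (x + x') - h x' t' \<le> p x" if "0 \<le> t'" for t'
      using that by (intro pge) (simp add: algebra_simps)
    then have "p (x + x') - p x \<le> p x'"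
      by (intro pge) (simp add: algebra_simps)
    then show ?thesis by simp
  qed
  have sc: "p (s *\<^sub>R x) \<le> s * p x" if s: "0 < s" for s x
  proof -
    have "p (s *\<^sub>R x) / s \<le> p x"
    proof (rule pge)
      fix t :: real assume t: "0 \<le> t"
      have "p (s *\<^sub>R x) \<le> h (s *\<^sub>R x) (s * t)" using s t by (intro ple) auto
      also have "\<dots> = s * h x t"
        using sublinear_scale[OF q less_imp_le[OF s], of "x + t *\<^sub>R y"]
        by (simp add: h_def algebra_simps)
      finally show "p (s *\<^sub>R x) / s \<le> h x t" using s by (simp add: field_simps)
    qed
    then show ?thesis using s by (simp add: field_simps)
  qed
  have p0: "p 0 = 0"
  proof -
    have "h 0 t = 0" if "0 \<le> t" for t using sublinear_scale[OF q that, of y] by (simp add: h_def)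
    then show ?thesis using ple[of 0 0] pge[of 0 0] by simp
  qed
  have "p (s *\<^sub>R x) = s * p x" if "0 \<le> s" for s x
  proof (cases "s = 0")
    case False
    then have s: "0 < s" using that by simp
    have "p x \<le> (1 / s) * p (s *\<^sub>R x)" using sc[of "1 / s" "s *\<^sub>R x"] s by simp
    then have "s * p x \<le> p (s *\<^sub>R x)" using s by (simp add: field_simps)
    then show ?thesis using sc[OF s, of x] by simp
  qed (simp add: p0)
  then have "sublinear p" using add by (simp add: sublinear_def)
  moreover have "p x \<le> q x" for x using ple[of 0 x] by (simp add: h_def)
  moreover have "p (- y) \<le> - q y" using ple[of 1 "- y"] sublinear_zero[OF q] by (simp add: h_def)
  ultimately show ?thesis using that by blast
qed

text \<open>A minimal sublinear functional is linear, because by minimality it coincides with each of its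
  tilts.\<close>

lemma linear_below_sublinear:
  fixes p :: "'a::real_vector \<Rightarrow> real"
  assumes p: "sublinear p"
  obtains f where "linear f" "\<And>x. f x \<le> p x"
proof -
  define A where "A = {q. sublinear q \<and> (\<forall>x. q x \<le> p x)}"
  \<comment> \<open>The pointwise order is reversed, so that a Zorn-maximal element is a minimal
    functional.\<close>
  define R where "R = (\<lambda>a b :: 'a \<Rightarrow> real. \<forall>x. b x \<le> a x)"
  have "\<exists>q\<in>A. \<forall>a\<in>A. R q a \<longrightarrow> a = q"
  proof (rule predicate_Zorn)
    show "partial_order_on A (relation_of R A)"
    proof (rule partial_order_on_relation_ofI)
      show "R a c" if "R a b" "R b c" for a b c
        using that unfolding R_def by (meson order_trans)
      show "a = b" if "R a b" "R b a" for a b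
        using that unfolding R_def by (intro ext) (meson order_antisym)
    qed (simp add: R_def)
  next
    fix C assume C: "C \<in> Chains (relation_of R A)"
    have CA: "C \<subseteq> A" using C by (auto simp: Chains_def relation_of_def)
    have ch: "R a b \<or> R b a" if "a \<in> C" "b \<in> C" for a b
      using C that by (auto simp: Chains_def relation_of_def)
    show "\<exists>u\<in>A. \<forall>a\<in>C. R a u"
    proof (cases "C = {}")
      case True
      then show ?thesis using p by (auto simp: A_def)
    next
      case False
      \<comment> \<open>The infimum of the chain is finite because its members dominate
        \<open>- p (- x)\<close>, and subadditive because the smaller of two members serves at both
        arguments.\<close>
      define u where "u x = (INF q\<in>C. q x)" for x
      have low: "- p (- x) \<le> q x" if "q \<in> C" for q x
      proof -
        have "sublinear q" "q (- x) \<le> p (- x)" using that CA by (auto simp: A_def)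
        then show ?thesis using sublinear_neg[of q x] by linarith
      qed
      have ule: "u x \<le> q x" if "q \<in> C" for q x
        unfolding u_def using that low by (intro cINF_lower bdd_belowI[of _ "- p (- x)"]) auto
      have uge: "b \<le> u x" if "\<And>q. q \<in> C \<Longrightarrow> b \<le> q x" for b x
        unfolding u_def using that False by (intro cINF_greatest) auto
      have "u (x + y) \<le> u x + u y" for x y
      proof -
        have "u (x + y) \<le> q x + q' y" if qq: "q \<in> C" "q' \<in> C" for q q'
        proof -
          obtain q'' where q'': "q'' \<in> C" "q'' x \<le> q x" "q'' y \<le> q' y"
            using ch[OF qq] qq by (auto simp: R_def)
          have "u (x + y) \<le> q'' (x + y)" by (rule ule[OF q''(1)])
          also have "\<dots> \<le> q'' x + q'' y" using q'' CA by (intro sublinear_add) (auto simp: A_def)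
          finally show ?thesis using q'' by simp
        qed
        then have "u (x + y) - q' y \<le> u x" if "q' \<in> C" for q'
          using that by (intro uge) (simp add: algebra_simps)
        then have "u (x + y) - u x \<le> u y" by (intro uge) (simp add: algebra_simps)
        then show ?thesis by simp
      qed
      moreover have "u (t *\<^sub>R x) = t * u x" if t: "0 \<le> t" for t x
      proof (cases "t = 0")
        case True
        have q0: "q 0 = 0" if "q \<in> C" for q using that CA by (auto simp: A_def sublinear_zero)
        obtain q where "q \<in> C" using False by blast
        then have "u 0 = 0" using ule[of q 0] uge[of 0 0] q0 by force
        then show ?thesis using True by simp
      next
        case t0: False
        then have t': "0 < t" using t by simp
        have q: "q (t *\<^sub>R x) = t * q x" if "q \<in> C" for q
          using that CA t by (auto simp: A_def sublinear_scale)
        have "u (t *\<^sub>R x) / t \<le> u x"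
        proof (rule uge)
          fix q assume "q \<in> C"
          then show "u (t *\<^sub>R x) / t \<le> q x" using ule[of q "t *\<^sub>R x"] q[of q] t' by (simp add: field_simps)
        qed
        moreover have "t * u x \<le> u (t *\<^sub>R x)"
        proof (rule uge)
          fix q assume "q \<in> C"
          then show "t * u x \<le> q (t *\<^sub>R x)" using ule[of q x] q[of q] t' by simp
        qed
        ultimately show ?thesis using t' by (simp add: field_simps)
      qed
      ultimately have "sublinear u" by (simp add: sublinear_def)
      moreover have "u x \<le> p x" for x
      proof -
        obtain q where q: "q \<in> C" using False by blast
        then have "q x \<le> p x" using CA by (auto simp: A_def)
        then show ?thesis using ule[OF q, of x] by linarith
      qed
      ultimately have "u \<in> A" by (simp add: A_def)
      then show ?thesis using ule by (auto simp: R_def)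
    qed
  qed
  then obtain q where qA: "q \<in> A" and qmin: "\<forall>a\<in>A. R q a \<longrightarrow> a = q" by blast
  have q: "sublinear q" "q x \<le> p x" for x using qA by (simp_all add: A_def)
  have min: "a = q" if a: "sublinear a" "\<forall>x. a x \<le> q x" for a
  proof -
    have "a x \<le> p x" for x using a(2) q(2)[of x] by (meson order_trans)
    then have "a \<in> A" using a(1) by (simp add: A_def)
    then show ?thesis using qmin a(2) by (simp add: R_def)
  qed
  have neg: "q (- y) = - q y" for y
  proof -
    obtain a where a: "sublinear a" "\<And>x. a x \<le> q x" "a (- y) \<le> - q y"
      using sublinear_tilt[OF q(1)] by blast
    have "a = q" using a(2) by (intro min[OF a(1)]) simp
    then show ?thesis using a(3) sublinear_neg[OF q(1), of "- y"] by simp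
  qed
  have "linear q"
  proof
    fix x y
    have "q (- x + - y) \<le> q (- x) + q (- y)" by (rule sublinear_add[OF q(1)])
    then have "q x + q y \<le> q (x + y)" using neg[of "x + y"] neg[of x] neg[of y] by simp
    then show "q (x + y) = q x + q y" using sublinear_add[OF q(1), of x y] by simp
  next
    fix t x
    show "q (t *\<^sub>R x) = t *\<^sub>R q x"
    proof (cases "0 \<le> t")
      case True
      then show ?thesis by (simp add: sublinear_scale[OF q(1)])
    next
      case False
      have "q (t *\<^sub>R x) = - q ((- t) *\<^sub>R x)" using neg[of "t *\<^sub>R x"] by simp
      also have "\<dots> = t * q x" using False by (subst sublinear_scale[OF q(1)]) auto
      finally show ?thesis by simp
    qed
  qed
  then show ?thesis using q that by blast
qed

text \<open>Tilting the norm along \<open>y\<close> first forces every linear minorant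
  \<open>f\<close> to satisfy \<open>f (- y) \<le> - norm y\<close>, so it attains the norm at
  \<open>y\<close>.\<close>

lemma norming_functional:
  fixes y :: "'a::real_normed_vector"
  shows "\<exists>f. linear f \<and> (\<forall>x. \<bar>f x\<bar> \<le> norm x) \<and> f y = norm y"
proof -
  obtain p where p: "sublinear p" "\<And>x. p x \<le> norm x" "p (- y) \<le> - norm y"
    using sublinear_tilt[OF sublinear_norm] by blast
  obtain f where f: "linear f" "\<And>x. f x \<le> p x" using linear_below_sublinear[OF p(1)] by blast
  have le: "f x \<le> norm x" for x using f(2)[of x] p(2)[of x] by linarith
  have neg: "f (- x) = - f x" for x by (rule linear_neg[OF f(1)])
  have "\<bar>f x\<bar> \<le> norm x" for x using le[of x] le[of "- x"] neg[of x] by simp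
  moreover have "f y = norm y" using f(2)[of "- y"] p(3) neg[of y] le[of y] by simp
  ultimately show ?thesis using f(1) by (intro exI[of _ f]) simp
qed

text \<open>By independence and compactness, the coordinate map \<open>F\<close> has norm at least
  \<open>d\<close> on the set \<open>U\<close> of coefficients with absolute sum 1. Hence unit
  vectors have coefficients of size at most \<open>1 / d\<close>, and the sphere is a closed part of
  the image of a compact box.\<close>

lemma compact_unit_sphere_finite_span:
  fixes S :: "'a::real_normed_vector set"
  assumes S: "finite S" "independent S"
  shows "compact (span S \<inter> sphere 0 1)"
proof -
  define F where "F c = (\<Sum>s\<in>S. c s *\<^sub>R s)" for c :: "'a \<Rightarrow> real"
  have contF: "continuous_on T F" for T
    unfolding F_def
    by (intro continuous_intros continuous_on_subset[OF continuous_on_product_coordinates]) auto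
  \<comment> \<open>Coefficients outside \<open>S\<close> are pinned to 0, so that the box is a
    product of compact sets over the whole type.\<close>
  define box where "box K = PiE UNIV (\<lambda>s. if s \<in> S then {- K..K} else {0::real})" for K
  have box: "compact (box K)" for K
  proof -
    have "compactin (product_topology (\<lambda>_. euclidean) UNIV) (box K)"
      unfolding box_def compactin_PiE by auto
    then show ?thesis by (simp add: euclidean_product_topology)
  qed
  define U where "U = box 1 \<inter> {c. (\<Sum>s\<in>S. \<bar>c s\<bar>) = 1}"
  have "closed {c. (\<Sum>s\<in>S. \<bar>c s\<bar>) = (1::real)}"
    by (intro closed_Collect_eq continuous_intros continuous_on_subset[OF continuous_on_product_coordinates]) auto
  then have U: "compact U" unfolding U_def using box by (intro compact_Int_closed) auto
  have "\<exists>d>0. \<forall>c\<in>U. d \<le> norm (F c)"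
  proof (cases "U = {}")
    case False
    obtain c0 where c0: "c0 \<in> U" "\<forall>c\<in>U. norm (F c0) \<le> norm (F c)"
      using continuous_attains_inf[OF U False, of "\<lambda>c. norm (F c)"] contF
      by (auto intro: continuous_intros)
    have "F c0 \<noteq> 0"
    proof
      assume "F c0 = 0"
      then have "\<forall>s\<in>S. c0 s = 0" using S unfolding F_def by (metis independentD order_refl)
      then show False using c0(1) by (simp add: U_def)
    qed
    then show ?thesis using c0 by (intro exI[of _ "norm (F c0)"]) auto
  qed (auto intro: exI[of _ 1])
  then obtain d where d: "0 < d" "\<And>c. c \<in> U \<Longrightarrow> d \<le> norm (F c)" by blast
  have "span S \<inter> sphere 0 1 \<subseteq> F ` box (1 / d)"
  proof
    fix y assume y: "y \<in> span S \<inter> sphere 0 1"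
    obtain g where g: "y = (\<Sum>s\<in>S. g s *\<^sub>R s)"
      using y span_finite[OF S(1)] by auto
    define c where "c s = (if s \<in> S then g s else 0)" for s
    have yF: "y = F c" unfolding g F_def c_def by simp
    define n where "n = (\<Sum>s\<in>S. \<bar>c s\<bar>)"
    have n0: "0 < n"
    proof (rule ccontr)
      assume "\<not> 0 < n"
      then have "n = 0" unfolding n_def by (simp add: sum_nonneg order_antisym not_less)
      then have "\<forall>s\<in>S. c s = 0" using S unfolding n_def by (simp add: sum_nonneg_eq_0_iff)
      then have "F c = 0" by (simp add: F_def)
      then show False using y yF by simp
    qed
    have cn: "\<bar>c s\<bar> \<le> n" if "s \<in> S" for s
      unfolding n_def using S that by (intro member_le_sum) auto
    have "(\<lambda>s. c s / n) \<in> U"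
    proof -
      have "c s / n \<in> (if s \<in> S then {-1..1} else {0})" for s
        using cn[of s] n0 by (auto simp: c_def field_simps)
      moreover have "(\<Sum>s\<in>S. \<bar>c s / n\<bar>) = 1"
        using n0 by (simp add: sum_divide_distrib[symmetric] n_def[symmetric])
      ultimately show ?thesis by (simp add: U_def box_def PiE_def Pi_def)
    qed
    then have "d \<le> norm (F (\<lambda>s. c s / n))" by (rule d)
    also have "F (\<lambda>s. c s / n) = (1 / n) *\<^sub>R F c"
      by (simp add: F_def scaleR_sum_right)
    also have "norm \<dots> = 1 / n" using y n0 by (simp add: yF[symmetric])
    finally have "n \<le> 1 / d" using n0 d by (simp add: field_simps)
    then have "\<bar>c s\<bar> \<le> 1 / d" if "s \<in> S" for s using cn[OF that] by linarith
    then have "c s \<in> (if s \<in> S then {-(1/d)..1/d} else {0})" for s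
      by (cases "s \<in> S") (auto simp: c_def abs_le_iff minus_le_iff)
    then have "c \<in> box (1 / d)" by (simp add: box_def PiE_def Pi_def)
    then show "y \<in> F ` box (1 / d)" using yF by blast
  qed
  moreover have "F c \<in> span S" for c
    unfolding F_def by (intro span_sum span_scale span_base)
  ultimately have "span S \<inter> sphere 0 1 = F ` box (1 / d) \<inter> sphere 0 1" by blast
  moreover have clo: "closed (sphere (0::'a) 1)"
    unfolding sphere_def by (intro closed_Collect_eq continuous_intros)
  ultimately show ?thesis
    using compact_Int_closed[OF compact_continuous_image[OF contF box] clo] by simp
qed

text \<open>Norming functionals are taken at the points of a finite \<open>e / 2\<close>-net.
  Passing to a nearby unit vector loses \<open>e / 2\<close> in the functional value and another
  \<open>e / 2\<close> because a net point need not be a unit vector.\<close>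

lemma finite_norming_set:
  fixes S :: "'a::real_normed_vector set"
  assumes S: "finite S" "independent S" and e: "0 < e"
  obtains F where "finite F" "F \<noteq> {}" "\<forall>f\<in>F. linear f" "\<forall>f\<in>F. \<forall>x. \<bar>f x\<bar> \<le> norm x"
    "\<forall>y\<in>span S. \<exists>f\<in>F. (1 - e) * norm y \<le> f y"
proof -
  have "\<exists>k. finite k \<and> span S \<inter> sphere 0 1 \<subseteq> (\<Union>x\<in>k. ball x (e / 2))"
    using compact_unit_sphere_finite_span[OF S] e unfolding compact_eq_totally_bounded by simp
  then obtain k where k: "finite k" "span S \<inter> sphere 0 1 \<subseteq> (\<Union>x\<in>k. ball x (e / 2))" by blast
  have ex: "\<forall>y::'a. \<exists>f. linear f \<and> (\<forall>x. \<bar>f x\<bar> \<le> norm x) \<and> f y = norm y"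
    by (intro allI norming_functional)
  obtain f :: "'a \<Rightarrow> 'a \<Rightarrow> real" where
    f': "\<forall>y. linear (f y) \<and> (\<forall>x. \<bar>f y x\<bar> \<le> norm x) \<and> f y y = norm y"
    using choice[OF ex] by blast
  then have f: "linear (f y)" "\<bar>f y x\<bar> \<le> norm x" "f y y = norm y" for x y by simp_all
  show ?thesis
  \<comment> \<open>The point 0 keeps the set nonempty when the net is empty.\<close>
  proof (rule that[of "f ` insert 0 k"])
    show "\<forall>y\<in>span S. \<exists>g\<in>f ` insert 0 k. (1 - e) * norm y \<le> g y"
    proof
      fix y assume y: "y \<in> span S"
      show "\<exists>g\<in>f ` insert 0 k. (1 - e) * norm y \<le> g y"
      proof (cases "y = 0")
        case True
        then show ?thesis using linear_0[OF f(1)] by auto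
      next
        case False
        define z where "z = (1 / norm y) *\<^sub>R y"
        have z: "z \<in> span S \<inter> sphere 0 1" using y False by (simp add: z_def span_scale)
        then obtain x where x: "x \<in> k" "dist x z < e / 2" using k by auto
        have "f x x = f x z + f x (x - z)" by (simp add: linear_diff[OF f(1)])
        moreover have "f x (x - z) \<le> e / 2" using f(2)[of x "x - z"] x by (simp add: dist_norm)
        moreover have "1 - e / 2 \<le> norm x" using z x norm_triangle_ineq2[of z x]
          by (simp add: dist_norm norm_minus_commute)
        ultimately have "1 - e \<le> f x z" using f(3)[of x] by (simp add: field_simps)
        also have "f x z = f x y / norm y" by (simp add: z_def linear_cmul[OF f(1)])
        finally have "(1 - e) * norm y \<le> f x y" using False by (simp add: field_simps)
        then show ?thesis using x by blast
      qed
    qed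
  qed (simp_all add: k f)
qed

section \<open>The upper bound\<close>

text \<open>\<open>z f\<close> is \<open>w f\<close> times the Riesz representative of
  \<open>f\<close> for the form \<open>B\<close>, so the reproducing identity is the Fourier
  expansion and \<open>k (z f)\<close> is \<open>w f\<close> times the inner product of the
  coordinate vectors of \<open>k\<close> and \<open>f\<close>. The floor \<open>h\<close> yields a
  bound uniform in the weights, which the minimax argument requires.\<close>

lemma weighted_decomposition:
  fixes F :: "('a::real_vector \<Rightarrow> real) set"
  assumes F: "finite F" "\<And>f. f \<in> F \<Longrightarrow> linear f"
    and S: "finite S" "independent S" and m: "2 \<le> card S"
    and total: "\<And>y. y \<in> span S \<Longrightarrow> (\<And>f. f \<in> F \<Longrightarrow> f y = 0) \<Longrightarrow> y = 0"
    and w: "\<And>f. f \<in> F \<Longrightarrow> h \<le> w f" "0 < h" "sum w F = 1"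
    and al: "0 < al" "al\<^sup>2 * (real (card S) + 2) = 1"
  obtains z where "\<forall>f\<in>F. z f \<in> span S"
    "\<forall>y\<in>span S. (\<Sum>f\<in>F. f y *\<^sub>R z f) = y"
    "(\<Sum>k\<in>F. w k * (\<Sum>f\<in>F. \<bar>k (z f)\<bar>)) \<le> (1 - al) * (1 + 2*al) / (al * (1 + al))"
    "\<forall>k\<in>F. (\<Sum>f\<in>F. \<bar>k (z f)\<bar>) \<le> card S / h"
proof -
  let ?m = "card S"
  have w0: "0 < w f" if "f \<in> F" for f using w(1)[OF that] w(2) by linarith
  define B where "B x y = (\<Sum>f\<in>F. w f * (f x * f y))" for x y
  have Blin: "linear (B x)" for x
    unfolding B_def
  proof (intro linear_compose_sum ballI)
    fix f assume "f \<in> F"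
    then have "linear f" by (rule F(2))
    then show "linear (\<lambda>y. w f * (f x * f y))"
      by (intro linearI) (simp_all add: linear_add linear_cmul algebra_simps)
  qed
  have Bsym: "B x y = B y x" for x y by (simp add: B_def mult_ac)
  have Bpos: "0 < B x x" if x: "x \<in> span S" "x \<noteq> 0" for x
  proof -
    obtain f where f: "f \<in> F" "f x \<noteq> 0" using total x by blast
    have "0 < w f * (f x * f x)" using f w0[OF f(1)] by (auto simp: zero_less_mult_iff)
    also have "\<dots> \<le> B x x" unfolding B_def
      using F f less_imp_le[OF w0] by (intro member_le_sum) auto
    finally show ?thesis .
  qed
  obtain e where e': "\<forall>a<?m. e a \<in> span S"
    "\<forall>a<?m. \<forall>b<?m. B (e a) (e b) = of_bool (a = b)"
    "\<forall>y\<in>span S. (\<Sum>a<?m. B (e a) y *\<^sub>R e a) = y"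
    using orthonormal_basis_exists[OF Blin Bsym S Bpos] by blast
  note e = e'[rule_format]
  define z where "z f = w f *\<^sub>R (\<Sum>a<?m. f (e a) *\<^sub>R e a)" for f
  have kz: "k (z f) = w f * (\<Sum>a<?m. k (e a) * f (e a))" if "k \<in> F" for k f
    using F(2)[OF that] by (simp add: z_def linear_cmul linear_sum mult_ac)
  have akz: "\<bar>k (z f)\<bar> = w f * \<bar>\<Sum>a<?m. k (e a) * f (e a)\<bar>" if "k \<in> F" "f \<in> F" for k f
    using w0[OF that(2)] unfolding kz[OF that(1)] abs_mult by simp
  show ?thesis
  proof
    show "\<forall>f\<in>F. z f \<in> span S"
      unfolding z_def using e by (intro ballI span_scale span_sum) auto
    show "\<forall>y\<in>span S. (\<Sum>f\<in>F. f y *\<^sub>R z f) = y"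
    proof
      fix y assume y: "y \<in> span S"
      have "(\<Sum>f\<in>F. f y *\<^sub>R z f) = (\<Sum>f\<in>F. \<Sum>a<?m. (w f * (f (e a) * f y)) *\<^sub>R e a)"
        by (simp add: z_def scaleR_sum_right mult_ac)
      also have "\<dots> = (\<Sum>a<?m. \<Sum>f\<in>F. (w f * (f (e a) * f y)) *\<^sub>R e a)" by (rule sum.swap)
      also have "\<dots> = y" using e(3)[OF y] by (simp add: B_def scaleR_sum_left)
      finally show "(\<Sum>f\<in>F. f y *\<^sub>R z f) = y" .
    qed
    have "(\<Sum>k\<in>F. w k * (\<Sum>f\<in>F. \<bar>k (z f)\<bar>))
        = (\<Sum>k\<in>F. \<Sum>f\<in>F. w k * w f * \<bar>\<Sum>a<?m. k (e a) * f (e a)\<bar>)"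
      by (simp add: akz sum_distrib_left mult.assoc)
    also have "\<dots> \<le> (1 - al) * (1 + 2*al) / (al * (1 + al))"
      by (rule isotropic_mean_abs_inner_le[OF less_imp_le[OF w0] w(3) e(2)[unfolded B_def] al m])
    finally show "(\<Sum>k\<in>F. w k * (\<Sum>f\<in>F. \<bar>k (z f)\<bar>)) \<le> (1 - al) * (1 + 2*al) / (al * (1 + al))" .
    show "\<forall>k\<in>F. (\<Sum>f\<in>F. \<bar>k (z f)\<bar>) \<le> ?m / h"
    proof
      fix k assume k: "k \<in> F"
      \<comment> \<open>This is one term of the weighted sum of squared lengths, whose total is the
        trace \<open>?m\<close>.\<close>
      have bd: "(\<Sum>a<?m. (f (e a))\<^sup>2) \<le> ?m / h" if f: "f \<in> F" for f
      proof -
        have "h * (\<Sum>a<?m. (f (e a))\<^sup>2) \<le> w f * (\<Sum>a<?m. (f (e a))\<^sup>2)"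
          using w(1)[OF f] by (intro mult_right_mono sum_nonneg) auto
        also have "\<dots> \<le> (\<Sum>f\<in>F. w f * (\<Sum>a<?m. (f (e a))\<^sup>2))"
          using F f less_imp_le[OF w0]
          by (intro member_le_sum[of f F "\<lambda>f. w f * (\<Sum>a<?m. (f (e a))\<^sup>2)"]) (auto intro!: mult_nonneg_nonneg sum_nonneg)
        also have "\<dots> = (\<Sum>f\<in>F. \<Sum>a<?m. w f * (f (e a) * f (e a)))"
          by (simp add: sum_distrib_left power2_eq_square)
        also have "\<dots> = (\<Sum>a<?m. B (e a) (e a))" unfolding B_def by (rule sum.swap)
        also have "\<dots> = ?m" by (simp add: e)
        finally show ?thesis using w(2) by (simp add: field_simps)
      qed
      have "(\<Sum>f\<in>F. \<bar>k (z f)\<bar>) \<le> (\<Sum>f\<in>F. w f * (?m / h))"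
      proof (rule sum_mono)
        fix f assume f: "f \<in> F"
        have "\<bar>\<Sum>a<?m. k (e a) * f (e a)\<bar> \<le> (\<Sum>a<?m. ((k (e a))\<^sup>2 + (f (e a))\<^sup>2) / 2)"
        proof (intro sum_abs[THEN order_trans] sum_mono)
          fix a
          show "\<bar>k (e a) * f (e a)\<bar> \<le> ((k (e a))\<^sup>2 + (f (e a))\<^sup>2) / 2"
            using sum_squares_bound[of "\<bar>k (e a)\<bar>" "\<bar>f (e a)\<bar>"] by (simp add: abs_mult)
        qed
        also have "\<dots> = ((\<Sum>a<?m. (k (e a))\<^sup>2) + (\<Sum>a<?m. (f (e a))\<^sup>2)) / 2"
          by (simp add: sum_divide_distrib[symmetric] sum.distrib)
        also have "\<dots> \<le> (?m / h + ?m / h) / 2"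
          by (intro divide_right_mono add_mono bd k f) simp
        also have "\<dots> = ?m / h" by simp
        finally show "\<bar>k (z f)\<bar> \<le> w f * (?m / h)"
          unfolding akz[OF k f] using w0[OF f] by (intro mult_left_mono) auto
      qed
      also have "\<dots> = ?m / h" unfolding sum_distrib_right[symmetric] w(3) by simp
      finally show "(\<Sum>f\<in>F. \<bar>k (z f)\<bar>) \<le> ?m / h" .
    qed
  qed
qed

text \<open>Minimax: one player picks a decomposition from a convex set, the other a weight on
  \<open>F\<close>. Weights may vanish, so responses are computed for a perturbed weight.\<close>

lemma finite_min_decomposition:
  fixes F :: "('a::real_vector \<Rightarrow> real) set"
  assumes F: "finite F" "F \<noteq> {}" "\<And>f. f \<in> F \<Longrightarrow> linear f"
    and S: "finite S" "independent S" and m: "2 \<le> card S"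
    and total: "\<And>y. y \<in> span S \<Longrightarrow> (\<And>f. f \<in> F \<Longrightarrow> f y = 0) \<Longrightarrow> y = 0"
    and al: "0 < al" "al\<^sup>2 * (real (card S) + 2) = 1"
    and d: "0 < d" "d < 1"
  obtains z where "\<forall>f\<in>F. z f \<in> span S"
    "\<forall>y\<in>span S. (\<Sum>f\<in>F. f y *\<^sub>R z f) = y"
    "\<forall>k\<in>F. (\<Sum>f\<in>F. \<bar>k (z f)\<bar>) \<le> ((1 - al) * (1 + 2*al) / (al * (1 + al))) / (1 - d) + d"
proof -
  let ?C = "(1 - al) * (1 + 2*al) / (al * (1 + al))"
  define feas where "feas z \<longleftrightarrow> (\<forall>f\<in>F. z f \<in> span S) \<and> (\<forall>y\<in>span S. (\<Sum>f\<in>F. f y *\<^sub>R z f) = y)"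
    for z :: "('a \<Rightarrow> real) \<Rightarrow> 'a"
  define V where "V = {v :: ('a \<Rightarrow> real) \<Rightarrow> real. \<exists>z. feas z \<and> v = (\<lambda>k. \<Sum>f\<in>F. \<bar>k (z f)\<bar>)}"
  define h where "h = d / card F"
  have N: "0 < card F" using F by (simp add: card_gt_0_iff)
  have h: "0 < h" using d N by (simp add: h_def)
  have "\<exists>v\<in>V. \<forall>k\<in>F. v k \<le> ?C / (1 - d) + d"
  proof (rule approx_minimax[OF F(1,2)])
    fix v v' and s :: real assume v: "v \<in> V" "v' \<in> V" and s: "0 \<le> s" "s \<le> 1"
    obtain z z' where z: "feas z" "v = (\<lambda>k. \<Sum>f\<in>F. \<bar>k (z f)\<bar>)" "feas z'" "v' = (\<lambda>k. \<Sum>f\<in>F. \<bar>k (z' f)\<bar>)"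
      using v by (auto simp: V_def)
    define y where "y f = (1 - s) *\<^sub>R z f + s *\<^sub>R z' f" for f
    have "feas y"
    proof -
      have "(\<Sum>f\<in>F. f x *\<^sub>R y f) = x" if x: "x \<in> span S" for x
      proof -
        have "(\<Sum>f\<in>F. f x *\<^sub>R y f) = (1 - s) *\<^sub>R (\<Sum>f\<in>F. f x *\<^sub>R z f) + s *\<^sub>R (\<Sum>f\<in>F. f x *\<^sub>R z' f)"
          by (simp add: y_def scaleR_sum_right sum.distrib[symmetric] scaleR_add_right mult.commute)
        then show ?thesis using z x by (simp add: feas_def algebra_simps)
      qed
      then show ?thesis using z by (simp add: feas_def y_def span_add span_scale)
    qed
    then have "(\<lambda>k. \<Sum>f\<in>F. \<bar>k (y f)\<bar>) \<in> V"
      unfolding V_def by (intro CollectI exI[of _ y] conjI refl)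
    moreover have "(\<Sum>f\<in>F. \<bar>k (y f)\<bar>) \<le> (1 - s) * v k + s * v' k" if k: "k \<in> F" for k
    proof -
      have "(\<Sum>f\<in>F. \<bar>k (y f)\<bar>) \<le> (\<Sum>f\<in>F. (1 - s) * \<bar>k (z f)\<bar> + s * \<bar>k (z' f)\<bar>)"
      proof (rule sum_mono)
        fix f
        have "k (y f) = (1 - s) * k (z f) + s * k (z' f)"
          using F(3)[OF k] by (simp add: y_def linear_add linear_cmul)
        then show "\<bar>k (y f)\<bar> \<le> (1 - s) * \<bar>k (z f)\<bar> + s * \<bar>k (z' f)\<bar>"
          using s abs_triangle_ineq[of "(1 - s) * k (z f)" "s * k (z' f)"] by (simp add: abs_mult)
      qed
      then show ?thesis by (simp add: z sum.distrib sum_distrib_left)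
    qed
    ultimately show "\<exists>v''\<in>V. \<forall>k\<in>F. v'' k \<le> (1 - s) * v k + s * v' k"
      by (intro bexI[of _ "\<lambda>k. \<Sum>f\<in>F. \<bar>k (y f)\<bar>"]) auto
  next
    fix w :: "('a \<Rightarrow> real) \<Rightarrow> real"
    assume w: "\<forall>k\<in>F. 0 \<le> w k" "sum w F = 1"
    \<comment> \<open>Mixing in the uniform weight gives the floor \<open>h\<close>; as
      \<open>w'\<close> dominates \<open>(1 - d) * w\<close>, it costs only the factor
      \<open>1 / (1 - d)\<close>.\<close>
    define w' where "w' f = (1 - d) * w f + h" for f
    have w'1: "h \<le> w' f" if "f \<in> F" for f using w that d by (simp add: w'_def)
    have w'2: "sum w' F = 1"
      using w N by (simp add: w'_def sum.distrib sum_distrib_left[symmetric] h_def)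
    obtain z where z: "\<forall>f\<in>F. z f \<in> span S" "\<forall>y\<in>span S. (\<Sum>f\<in>F. f y *\<^sub>R z f) = y"
      "(\<Sum>k\<in>F. w' k * (\<Sum>f\<in>F. \<bar>k (z f)\<bar>)) \<le> ?C"
      "\<forall>k\<in>F. (\<Sum>f\<in>F. \<bar>k (z f)\<bar>) \<le> card S / h"
      by (rule weighted_decomposition[OF F(1,3) S m total w'1 h w'2 al])
    have "(1 - d) * (\<Sum>k\<in>F. w k * (\<Sum>f\<in>F. \<bar>k (z f)\<bar>)) \<le> (\<Sum>k\<in>F. w' k * (\<Sum>f\<in>F. \<bar>k (z f)\<bar>))"
      unfolding sum_distrib_left[of "1 - d"] mult.assoc[symmetric]
      using h by (intro sum_mono mult_right_mono sum_nonneg) (auto simp: w'_def)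
    also note z(3)
    finally have "(\<Sum>k\<in>F. w k * (\<Sum>f\<in>F. \<bar>k (z f)\<bar>)) \<le> ?C / (1 - d)"
      using d by (subst pos_le_divide_eq) (simp_all only: mult.commute diff_gt_0_iff_gt)
    moreover have "(\<lambda>k. \<Sum>f\<in>F. \<bar>k (z f)\<bar>) \<in> V"
    proof -
      have "feas z" unfolding feas_def using z(1,2) by blast
      then show ?thesis unfolding V_def by (intro CollectI exI[of _ z] conjI refl)
    qed
    moreover have "\<forall>k\<in>F. \<bar>\<Sum>f\<in>F. \<bar>k (z f)\<bar>\<bar> \<le> card S / h"
      using z(4) by (simp add: sum_nonneg)
    ultimately show "\<exists>v\<in>V. (\<Sum>k\<in>F. w k * v k) \<le> ?C / (1 - d) \<and> (\<forall>k\<in>F. \<bar>v k\<bar> \<le> card S / h)"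
      by (intro bexI[of _ "\<lambda>k. \<Sum>f\<in>F. \<bar>k (z f)\<bar>"]) auto
  qed (rule d)
  then obtain z where "feas z" "\<forall>k\<in>F. (\<Sum>f\<in>F. \<bar>k (z f)\<bar>) \<le> ?C / (1 - d) + d"
    by (auto simp: V_def)
  then show ?thesis unfolding feas_def by (intro that[of z]) simp_all
qed

text \<open>The functionals in \<open>F\<close> detect \<open>norm (P x)\<close> up to the factor
  \<open>1 - d\<close>, and each \<open>k\<close> in \<open>F\<close> is bounded on
  \<open>P x\<close> by \<open>norm x\<close> times the sum of the
  \<open>\<bar>k (z f)\<bar>\<close>.\<close>

theorem projection_exists:
  fixes Y :: "'a::real_normed_vector set"
  assumes Y: "fin_dim_subspace m Y" and m: "2 \<le> m"
    and al: "0 < al" "al\<^sup>2 * (real m + 2) = 1" and e: "0 < e"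
  obtains P where "bounded_linear P" "range P = Y" "\<forall>y\<in>Y. P y = y"
    "onorm P \<le> (1 - al) * (1 + 2*al) / (al * (1 + al)) + e"
proof -
  let ?C = "(1 - al) * (1 + 2*al) / (al * (1 + al))"
  obtain S where S: "finite S" "independent S" "span S = Y" "card S = m"
    using Y by (auto simp: fin_dim_subspace_def)
  \<comment> \<open>The outer division is the loss in norming; the inner one and the summand
    \<open>d\<close> come from the minimax step. All vanish as \<open>d\<close> tends to 0.\<close>
  obtain d where d: "0 < d" "d < 1" "(?C / (1 - d) + d) / (1 - d) < ?C + e"
  proof -
    have "((\<lambda>d. (?C / (1 - d) + d) / (1 - d)) \<longlongrightarrow> (?C / (1 - 0) + 0) / (1 - 0)) (at_right 0)"
      by (intro tendsto_intros) auto
    then have "\<forall>\<^sub>F d in at_right 0. (?C / (1 - d) + d) / (1 - d) < ?C + e"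
      by (rule order_tendstoD) (use e in simp)
    moreover have "\<forall>\<^sub>F d in at_right (0::real). 0 < d" by (rule eventually_at_right_less)
    moreover have "\<forall>\<^sub>F d in at_right (0::real). d < 1"
      by (rule order_tendstoD[OF tendsto_ident_at]) simp
    ultimately have "\<forall>\<^sub>F d in at_right 0. 0 < d \<and> d < 1 \<and> (?C / (1 - d) + d) / (1 - d) < ?C + e"
      by eventually_elim simp
    then show ?thesis using that eventually_happens'[OF trivial_limit_at_right_real] by blast
  qed
  obtain F where F': "finite F" "F \<noteq> {}" "\<forall>f\<in>F. linear f" "\<forall>f\<in>F. \<forall>x. \<bar>f x\<bar> \<le> norm x"
    "\<forall>y\<in>span S. \<exists>f\<in>F. (1 - d) * norm y \<le> f y"
    by (rule finite_norming_set[OF S(1,2) d(1)])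
  note F = F'(1,2) F'(3-5)[rule_format]
  have total: "y = 0" if y: "y \<in> span S" "\<And>f. f \<in> F \<Longrightarrow> f y = 0" for y
  proof -
    obtain f where f: "f \<in> F" "(1 - d) * norm y \<le> f y" using F(5)[OF y(1)] by blast
    then have "(1 - d) * norm y \<le> 0" using y(2)[OF f(1)] by simp
    then show ?thesis using d by (simp add: mult_le_0_iff)
  qed
  obtain z where z': "\<forall>f\<in>F. z f \<in> span S" "\<forall>y\<in>span S. (\<Sum>f\<in>F. f y *\<^sub>R z f) = y"
    "\<forall>k\<in>F. (\<Sum>f\<in>F. \<bar>k (z f)\<bar>) \<le> ?C / (1 - d) + d"
    by (rule finite_min_decomposition[OF F(1-3) S(1,2) m[folded S(4)] total al[folded S(4)] d(1,2)])
  note z = z'[rule_format]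
  define P where "P x = (\<Sum>f\<in>F. f x *\<^sub>R z f)" for x
  have lin: "linear P"
    unfolding P_def
  proof (intro linear_compose_sum ballI)
    fix f assume "f \<in> F"
    then have "linear f" by (rule F(3))
    then show "linear (\<lambda>x. f x *\<^sub>R z f)"
      by (intro linearI) (simp_all add: linear_add linear_cmul algebra_simps)
  qed
  have Pin: "P x \<in> span S" for x unfolding P_def using z by (intro span_sum span_scale) auto
  have bound: "norm (P x) \<le> norm x * (?C + e)" for x
  proof -
    obtain k where k: "k \<in> F" "(1 - d) * norm (P x) \<le> k (P x)" using F(5)[OF Pin] by blast
    note k(2)
    also have "k (P x) = (\<Sum>f\<in>F. f x * k (z f))"
      using F(3)[OF k(1)] by (simp add: P_def linear_sum linear_cmul)
    also have "\<dots> \<le> (\<Sum>f\<in>F. norm x * \<bar>k (z f)\<bar>)"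
    proof (rule sum_mono)
      fix f assume "f \<in> F"
      then have "\<bar>f x\<bar> * \<bar>k (z f)\<bar> \<le> norm x * \<bar>k (z f)\<bar>" using F(4) by (intro mult_right_mono) auto
      then show "f x * k (z f) \<le> norm x * \<bar>k (z f)\<bar>" using abs_ge_self[of "f x * k (z f)"] by (simp add: abs_mult)
    qed
    also have "\<dots> \<le> norm x * (?C / (1 - d) + d)"
      using z(3)[OF k(1)] by (simp add: sum_distrib_left[symmetric] mult_left_mono)
    finally have "norm (P x) \<le> norm x * ((?C / (1 - d) + d) / (1 - d))"
      using d by (simp add: pos_le_divide_eq mult.commute)
    also have "\<dots> \<le> norm x * (?C + e)" using d(3) by (intro mult_left_mono) auto
    finally show ?thesis .
  qed
  have Py: "P y = y" if "y \<in> Y" for y using z(2) that S by (simp add: P_def)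
  show ?thesis
  proof
    show "bounded_linear P" using lin bound
      by (intro bounded_linear_intro[of P "?C + e"] linear_add linear_cmul)
    show "\<forall>y\<in>Y. P y = y" using Py by blast
    show "range P = Y"
    proof
      show "range P \<subseteq> Y" using Pin S(3) by blast
      show "Y \<subseteq> range P" using Py by (metis rangeI subsetI)
    qed
    show "onorm P \<le> ?C + e"
    proof (rule onorm_bound)
      \<comment> \<open>\<open>al \<le> 1\<close> makes the constant nonnegative, as
        \<open>onorm_bound\<close> demands.\<close>
      have "al\<^sup>2 * 1 \<le> al\<^sup>2 * (real m + 2)" by (intro mult_left_mono) auto
      then have "al \<le> 1" using al by (simp add: abs_square_le_1)
      then show "0 \<le> ?C + e" using al e by (intro add_nonneg_nonneg divide_nonneg_pos) auto
      show "norm (P x) \<le> (?C + e) * norm x" for x using bound[of x] by (simp add: mult.commute)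
    qed
  qed
qed

corollary rel_proj_const_le:
  fixes Y :: "'a::real_normed_vector set"
  assumes Y: "fin_dim_subspace m Y" and m: "2 \<le> m" and al: "0 < al" "al\<^sup>2 * (real m + 2) = 1"
  shows "rel_proj_const Y \<le> (1 - al) * (1 + 2*al) / (al * (1 + al))"
proof (rule field_le_epsilon)
  fix e :: real assume e: "0 < e"
  obtain P where P: "bounded_linear P" "range P = Y" "\<forall>y\<in>Y. P y = y"
    "onorm P \<le> (1 - al) * (1 + 2*al) / (al * (1 + al)) + e"
    by (rule projection_exists[OF Y m al e])
  have "rel_proj_const Y \<le> onorm P"
    unfolding rel_proj_const_def using P onorm_pos_le
    by (intro cInf_lower bdd_belowI[of _ 0]) auto
  then show "rel_proj_const Y \<le> (1 - al) * (1 + 2*al) / (al * (1 + al)) + e" using P(4) by simp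
qed

section \<open>The lower bound from equiangular lines\<close>

text \<open>With \<open>m * (m + 1) / 2\<close> lines at this angle, the squared distance of the frame operator from the
  multiple of the identity of equal trace is zero.\<close>

lemma equiangular_tight:
  fixes u :: "nat \<Rightarrow> nat \<Rightarrow> real"
  assumes m: "1 \<le> m" and N: "2 * N = m * (m + 1)"
    and al: "al\<^sup>2 * (real m + 2) = 1"
    and diag: "\<And>i. i < N \<Longrightarrow> (\<Sum>a<m. u i a * u i a) = K"
    and off: "\<And>i j. i < N \<Longrightarrow> j < N \<Longrightarrow> i \<noteq> j \<Longrightarrow> \<bar>\<Sum>a<m. u i a * u j a\<bar> = al * K"
    and ab: "a < m" "b < m"
  shows "(\<Sum>i<N. u i a * u i b) = real N * K / m * of_bool (a = b)"
proof -
  define T where "T = (\<lambda>(a,b). \<Sum>i<N. u i a * u i b)"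
  define D :: "nat \<times> nat \<Rightarrow> real" where "D = (\<lambda>(a,b). of_bool (a = b))"
  define t where "t = real N * K / m"
  let ?Q = "{..<m} \<times> {..<m}"
  have m0: "real m \<noteq> 0" using m by simp
  have N': "2 * real N = real m * (real m + 1)"
    using N by (metis (no_types) of_nat_1 of_nat_add of_nat_mult of_nat_numeral)
  have TT: "(\<Sum>q\<in>?Q. (T q)\<^sup>2) = real N * K\<^sup>2 * (1 + (real N - 1) * al\<^sup>2)"
  proof -
    have "(\<Sum>q\<in>?Q. (T q)\<^sup>2) = (\<Sum>q\<in>?Q. (\<Sum>i<N. 1 * (case q of (a,b) \<Rightarrow> u i a * u i b))\<^sup>2)"
      by (intro sum.cong refl) (auto simp: T_def)
    also have "\<dots> = (\<Sum>i<N. \<Sum>j<N. \<Sum>q\<in>?Q. (case q of (a,b) \<Rightarrow> u i a * u i b) * (case q of (a,b) \<Rightarrow> u j a * u j b))"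
      unfolding sum_square_product by simp
    also have "\<dots> = (\<Sum>i<N. \<Sum>j<N. (\<Sum>a<m. u i a * u j a)\<^sup>2)"
      unfolding power2_eq_square sum_product sum.cartesian_product
      by (intro sum.cong refl) auto
    also have "\<dots> = (\<Sum>i<N. \<Sum>j<N. (al * K)\<^sup>2 + (K\<^sup>2 - (al * K)\<^sup>2) * of_bool (i = j))"
    proof (intro sum.cong refl)
      fix i j assume ij: "i \<in> {..<N}" "j \<in> {..<N}"
      show "(\<Sum>a<m. u i a * u j a)\<^sup>2 = (al * K)\<^sup>2 + (K\<^sup>2 - (al * K)\<^sup>2) * of_bool (i = j)"
      proof (cases "i = j")
        case True
        then show ?thesis using diag ij by simp
      next
        case False
        then have a: "\<bar>\<Sum>a<m. u i a * u j a\<bar> = al * K" using off ij by simp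
        have "(\<Sum>a<m. u i a * u j a)\<^sup>2 = \<bar>\<Sum>a<m. u i a * u j a\<bar>\<^sup>2" by simp
        then show ?thesis unfolding a using False by simp
      qed
    qed
    also have "\<dots> = real N * (real N * (al * K)\<^sup>2) + real N * (K\<^sup>2 - (al * K)\<^sup>2)"
    proof -
      have d: "(\<Sum>i<N. \<Sum>j<N. of_bool (i = j)) = real N" by (simp add: of_bool_def)
      show ?thesis by (simp only: sum.distrib sum_distrib_left[symmetric] d) simp
    qed
    finally show ?thesis by (simp add: power_mult_distrib algebra_simps)
  qed
  have TD: "(\<Sum>q\<in>?Q. T q * D q) = real N * K"
  proof -
    have "(\<Sum>q\<in>?Q. T q * D q) = (\<Sum>a<m. \<Sum>b<m. T (a,b) * of_bool (a = b))"
      unfolding sum.cartesian_product by (intro sum.cong refl) (auto simp: D_def)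
    also have "\<dots> = (\<Sum>a<m. T (a,a))" by (simp add: of_bool_def if_distrib cong: if_cong)
    also have "\<dots> = (\<Sum>i<N. \<Sum>a<m. u i a * u i a)" unfolding T_def by (simp, rule sum.swap)
    finally show ?thesis by (simp add: diag)
  qed
  have DD: "(\<Sum>q\<in>?Q. D q * D q) = real m"
  proof -
    have "(\<Sum>q\<in>?Q. D q * D q) = (\<Sum>a<m. \<Sum>b<m. of_bool (a = b))"
      unfolding sum.cartesian_product by (intro sum.cong refl) (auto simp: D_def)
    then show ?thesis by (simp add: of_bool_def)
  qed
  have "(\<Sum>q\<in>?Q. (T q - t * D q)\<^sup>2) = (\<Sum>q\<in>?Q. (T q)\<^sup>2 - 2 * t * (T q * D q) + t\<^sup>2 * (D q * D q))"
    by (intro sum.cong refl) (simp add: power2_eq_square algebra_simps)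
  also have "\<dots> = (\<Sum>q\<in>?Q. (T q)\<^sup>2) - 2 * t * (\<Sum>q\<in>?Q. T q * D q) + t\<^sup>2 * (\<Sum>q\<in>?Q. D q * D q)"
    by (simp only: sum.distrib sum_subtractf sum_distrib_left)
  also have "\<dots> = real N * K\<^sup>2 * (1 + (real N - 1) * al\<^sup>2 - real N / m)"
    unfolding TT TD DD using m0 by (simp add: t_def field_simps power2_eq_square)
  \<comment> \<open>The number of lines and the angle enter here: \<open>(N - 1) * al^2\<close> is
    \<open>(m - 1) / 2\<close> and \<open>N / m\<close> is \<open>(m + 1) / 2\<close>.\<close>
  also have "1 + (real N - 1) * al\<^sup>2 - real N / m = 0"
  proof -
    have n: "real N = real m * (real m + 1) / 2" using N' by simp
    have "(real N - 1) * al\<^sup>2 = (real m - 1) / 2 * (al\<^sup>2 * (real m + 2))"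
      unfolding n by (simp add: field_simps)
    also have "\<dots> = (real m - 1) / 2" unfolding al by simp
    finally have 1: "(real N - 1) * al\<^sup>2 = (real m - 1) / 2" .
    have 2: "real N / m = (real m + 1) / 2" unfolding n using m0 by simp
    show ?thesis unfolding 1 2 by (simp add: field_simps)
  qed
  finally have "(\<Sum>q\<in>?Q. (T q - t * D q)\<^sup>2) = 0" by simp
  then have "\<forall>q\<in>?Q. (T q - t * D q)\<^sup>2 = 0" by (subst (asm) sum_nonneg_eq_0_iff) auto
  then have "T (a,b) - t * D (a,b) = 0" using ab by (metis SigmaI lessThan_iff power_eq_0_iff)
  then show ?thesis by (simp add: T_def D_def t_def)
qed

section \<open>Finitely supported elements of the sequence space\<close>

definition linf_of :: "nat \<Rightarrow> (nat \<Rightarrow> real) \<Rightarrow> linf" where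
  "linf_of N g = Bcontfun (\<lambda>i. if i < N then g i else 0)"

text \<open>As \<open>nat\<close> is discrete, only boundedness has to be checked, and the range is
  finite.\<close>

lemma apply_linf_of [simp]: "apply_bcontfun (linf_of N g) i = (if i < N then g i else 0)"
proof -
  have "range (\<lambda>i. if i < N then g i else 0) \<subseteq> insert 0 (g ` {..<N})" by auto
  then have "bounded (range (\<lambda>i. if i < N then g i else 0))"
    by (meson finite_imp_bounded finite_imageI finite_insert finite_lessThan bounded_subset)
  then have "(\<lambda>i. if i < N then g i else 0) \<in> bcontfun" by (simp add: bcontfun_def)
  then show ?thesis by (simp add: linf_of_def Bcontfun_inverse)
qed

lemma apply_bcontfun_sum: "apply_bcontfun (\<Sum>a\<in>A. f a) i = (\<Sum>a\<in>A. apply_bcontfun (f a) i)"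
  by (induction A rule: infinite_finite_induct) auto

text \<open>The coordinate sequences \<open>B a\<close> span \<open>Y\<close> and are eigenvectors
  of the sign matrix \<open>s\<close> with eigenvalue \<open>M\<close>. Pairing the matrix of
  \<open>P\<close> with \<open>s\<close> therefore gives \<open>M * m\<close>, while each of the
  \<open>N\<close> rows contributes at most \<open>onorm P\<close>.\<close>

theorem equiangular_projection_bound:
  fixes u :: "nat \<Rightarrow> nat \<Rightarrow> real"
  assumes m: "1 \<le> m" and N: "2 * N = m * (m + 1)"
    and al: "0 < al" "al\<^sup>2 * (real m + 2) = 1" and K: "0 < K"
    and diag: "\<And>i. i < N \<Longrightarrow> (\<Sum>a<m. u i a * u i a) = K"
    and off: "\<And>i j. i < N \<Longrightarrow> j < N \<Longrightarrow> i \<noteq> j \<Longrightarrow> \<bar>\<Sum>a<m. u i a * u j a\<bar> = al * K"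
  obtains Y :: "linf set" where "fin_dim_subspace m Y"
    "\<forall>P. bounded_linear P \<and> range P = Y \<and> (\<forall>y\<in>Y. P y = y) \<longrightarrow>
        (1 - al) * (1 + 2*al) / (al * (1 + al)) \<le> onorm P"
proof -
  have m0: "0 < real m" using m by simp
  have N': "2 * real N = real m * (real m + 1)"
    using N by (metis (no_types) of_nat_1 of_nat_add of_nat_mult of_nat_numeral)
  have N0: "0 < real N" using N' m0 by (smt (verit) mult_pos_pos)
  define t where "t = real N * K / m"
  have t0: "0 < t" using N0 K m0 by (simp add: t_def)
  have tight: "(\<Sum>i<N. u i a * u i b) = t * of_bool (a = b)" if "a < m" "b < m" for a b
    unfolding t_def by (rule equiangular_tight[OF m N al(2) diag off that])
  have delta: "(\<Sum>a<n. f a * of_bool (a = b)) = f b" "(\<Sum>a<n. f a * of_bool (b = a)) = f b"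
    if "b < n" for f :: "nat \<Rightarrow> real" and b n
    using that by (simp_all add: of_bool_def if_distrib cong: if_cong)
  define B where "B a = linf_of N (\<lambda>i. u i a)" for a
  have coef: "c b = 0" if b: "b < m" and z: "(\<Sum>a<m. c a *\<^sub>R B a) = 0" for c b
  proof -
    \<comment> \<open>Pairing with the coordinate sequence \<open>b\<close> isolates one
      coefficient, by tightness.\<close>
    have "0 = (\<Sum>i<N. u i b * apply_bcontfun (\<Sum>a<m. c a *\<^sub>R B a) i)" by (simp add: z)
    also have "\<dots> = (\<Sum>i<N. \<Sum>a<m. c a * (u i a * u i b))"
      by (simp add: apply_bcontfun_sum B_def sum_distrib_left mult_ac)
    also have "\<dots> = (\<Sum>a<m. \<Sum>i<N. c a * (u i a * u i b))" by (rule sum.swap)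
    also have "\<dots> = (\<Sum>a<m. c a * t * of_bool (a = b))"
      using b by (simp add: sum_distrib_left[symmetric] tight mult.assoc)
    also have "\<dots> = c b * t" using b by (simp only: delta)
    finally show ?thesis using t0 by simp
  qed
  have inj: "inj_on B {..<m}"
  proof (rule inj_onI, rule ccontr)
    fix a b assume ab: "a \<in> {..<m}" "b \<in> {..<m}" "B a = B b" "a \<noteq> b"
    have "(\<Sum>c<m. (of_bool (c = a) - of_bool (c = b)) *\<^sub>R B c) = B a - B b"
      using ab by (simp add: scaleR_diff_left sum_subtractf of_bool_def if_distrib[of "\<lambda>x. x *\<^sub>R _"] cong: if_cong)
    then have "of_bool (a = a) - of_bool (a = b) = (0::real)" using ab by (intro coef) auto
    then show False using ab by simp
  qed
  define Y where "Y = span (B ` {..<m})"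
  have "independent (B ` {..<m})"
  proof (rule independent_if_scalars_zero)
    fix f x assume f: "(\<Sum>x\<in>B ` {..<m}. f x *\<^sub>R x) = 0" and x: "x \<in> B ` {..<m}"
    have "(\<Sum>a<m. f (B a) *\<^sub>R B a) = 0" using f by (simp add: sum.reindex[OF inj])
    then show "f x = 0" using coef[of _ "\<lambda>a. f (B a)"] x by auto
  qed simp
  then have fin: "fin_dim_subspace m Y"
    unfolding fin_dim_subspace_def Y_def using card_image[OF inj]
    by (intro conjI exI[of _ "B ` {..<m}"]) auto
  have Yrep: "\<exists>c. y = (\<Sum>a<m. c a *\<^sub>R B a)" if "y \<in> Y" for y
    using that span_finite[of "B ` {..<m}"] by (auto simp: Y_def sum.reindex[OF inj])
  have main: "(1 - al) * (1 + 2*al) / (al * (1 + al)) \<le> onorm P"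
    if P: "bounded_linear P" "range P = Y" "\<And>y. y \<in> Y \<Longrightarrow> P y = y" for P
  proof -
    have lin: "linear P" using P(1) by (simp add: bounded_linear.linear)
    define E where "E j = linf_of N (\<lambda>i. of_bool (i = j))" for j
    have LE: "linf_of N g = (\<Sum>j<N. g j *\<^sub>R E j)" for g
      by (rule bcontfun_eqI) (simp add: apply_bcontfun_sum E_def delta)
    have "\<forall>j. \<exists>c. P (E j) = (\<Sum>a<m. c a *\<^sub>R B a)" using P(2) Yrep by blast
    then obtain z where z: "\<And>j. P (E j) = (\<Sum>a<m. z j a *\<^sub>R B a)" by metis
    \<comment> \<open>Biorthogonality expresses that \<open>P\<close> fixes every
      \<open>B a\<close>; its diagonal gives the trace \<open>m\<close>.\<close>
    have dual: "(\<Sum>j<N. u j a * z j c) = of_bool (a = c)" if a: "a < m" and c: "c < m" for a c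
    proof -
      have "B a = P (B a)" using P(3) a by (simp add: Y_def span_base)
      also have "\<dots> = (\<Sum>j<N. u j a *\<^sub>R P (E j))"
        by (simp add: B_def LE linear_sum[OF lin] linear_cmul[OF lin])
      also have "\<dots> = (\<Sum>j<N. \<Sum>c<m. (u j a * z j c) *\<^sub>R B c)"
        by (simp add: z scaleR_sum_right)
      also have "\<dots> = (\<Sum>c<m. \<Sum>j<N. (u j a * z j c) *\<^sub>R B c)" by (rule sum.swap)
      finally have 1: "B a = (\<Sum>c<m. (\<Sum>j<N. u j a * z j c) *\<^sub>R B c)" by (simp add: scaleR_sum_left)
      have 2: "B a = (\<Sum>c<m. of_bool (a = c) *\<^sub>R B c)"
        using a by (simp add: of_bool_def if_distrib[of "\<lambda>x. x *\<^sub>R _"] cong: if_cong)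
      have "(\<Sum>c<m. ((\<Sum>j<N. u j a * z j c) - of_bool (a = c)) *\<^sub>R B c) = 0"
        using 1 2 by (simp add: scaleR_diff_left sum_subtractf)
      from coef[OF c this] show ?thesis by simp
    qed
    define G where "G k j = (\<Sum>a<m. u k a * u j a)" for k j
    define s where "s k j = sgn (G k j)" for k j
    \<comment> \<open>The signs are affine in the Gram matrix: off the diagonal all entries have
      size \<open>al * K\<close>, and the diagonal value \<open>1 / al\<close> is corrected to
      1.\<close>
    have s: "s k j = G k j / (al * K) + (1 - 1 / al) * of_bool (k = j)" if "k < N" "j < N" for k j
    proof (cases "k = j")
      case True
      then show ?thesis using diag that K al by (simp add: s_def G_def field_simps)
    next
      case False
      then have "\<bar>G k j\<bar> = al * K" using off that by (simp add: G_def)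
      then show ?thesis unfolding s_def real_sgn_eq using False by simp
    qed
    define M where "M = t / (al * K) + 1 - 1 / al"
    have eig: "(\<Sum>k<N. s k j * u k a) = M * u j a" if j: "j < N" and a: "a < m" for j a
    proof -
      have "(\<Sum>k<N. G k j * u k a) = (\<Sum>k<N. \<Sum>b<m. u j b * (u k b * u k a))"
        unfolding G_def sum_distrib_right by (intro sum.cong refl) simp
      also have "\<dots> = (\<Sum>b<m. \<Sum>k<N. u j b * (u k b * u k a))" by (rule sum.swap)
      also have "\<dots> = (\<Sum>b<m. u j b * t * of_bool (b = a))"
        using a by (simp add: sum_distrib_left[symmetric] tight mult.assoc)
      also have "\<dots> = u j a * t" using a by (simp only: delta)
      finally have Gu: "(\<Sum>k<N. G k j * u k a) = u j a * t" .
      have "(\<Sum>k<N. s k j * u k a) = (\<Sum>k<N. (1 / (al * K)) * (G k j * u k a) + (1 - 1 / al) * (u k a * of_bool (k = j)))"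
        using j by (intro sum.cong refl) (simp add: s algebra_simps)
      also have "\<dots> = (1 / (al * K)) * (u j a * t) + (1 - 1 / al) * u j a"
        unfolding sum.distrib sum_distrib_left[symmetric] Gu delta(1)[OF j] ..
      finally show ?thesis by (simp add: M_def algebra_simps)
    qed
    have row: "(\<Sum>j<N. s k j * (\<Sum>a<m. z j a * u k a)) \<le> onorm P" if k: "k < N" for k
    proof -
      \<comment> \<open>The \<open>k\<close>-th row of signs is a vector of norm at most 1, and the
        row sum is the \<open>k\<close>-th coordinate of its image.\<close>
      define f where "f = linf_of N (s k)"
      have "norm f \<le> 1" by (rule norm_bound) (simp add: f_def s_def abs_sgn_eq)
      have "(\<Sum>j<N. s k j * (\<Sum>a<m. z j a * u k a)) = apply_bcontfun (P f) k"
      proof -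
        have "P f = (\<Sum>j<N. s k j *\<^sub>R P (E j))"
          unfolding f_def LE by (simp add: linear_sum[OF lin] linear_cmul[OF lin])
        then show ?thesis using k by (simp add: z apply_bcontfun_sum B_def)
      qed
      also have "\<dots> \<le> norm (P f)" using norm_bounded[of "P f" k] by simp
      also have "\<dots> \<le> onorm P * norm f" by (rule onorm[OF P(1)])
      also have "\<dots> \<le> onorm P * 1" using \<open>norm f \<le> 1\<close> onorm_pos_le[OF P(1)] by (rule mult_left_mono)
      finally show ?thesis by simp
    qed
    have "M * real m = (\<Sum>a<m. \<Sum>j<N. M * (u j a * z j a))"
      by (simp add: sum_distrib_left[symmetric] dual)
    also have "\<dots> = (\<Sum>j<N. \<Sum>a<m. M * (u j a * z j a))" by (rule sum.swap)
    also have "\<dots> = (\<Sum>j<N. \<Sum>a<m. z j a * (\<Sum>k<N. s k j * u k a))"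
      by (intro sum.cong refl) (simp add: eig)
    also have "\<dots> = (\<Sum>j<N. \<Sum>k<N. \<Sum>a<m. s k j * (z j a * u k a))"
      unfolding sum_distrib_left by (subst sum.swap) (simp add: mult_ac)
    also have "\<dots> = (\<Sum>k<N. \<Sum>j<N. s k j * (\<Sum>a<m. z j a * u k a))"
      by (subst sum.swap) (simp add: sum_distrib_left)
    also have "\<dots> \<le> (\<Sum>k<N. onorm P)" by (intro sum_mono row) simp
    finally have le: "M * real m / real N \<le> onorm P" using N0 by (simp add: field_simps)
    have "M * real m / real N = 1 / al - 2 / (real m + 1) * ((1 - al) / al)"
    proof -
      have "real m / real N = 2 / (real m + 1)" using N' N0 m0 by (simp add: field_simps)
      moreover have "M * real m / real N = 1 / al - (real m / real N) * ((1 - al) / al)"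
        unfolding M_def t_def using N0 m0 K al by (simp add: field_simps)
      ultimately show ?thesis by simp
    qed
    also have "\<dots> = (1 - al) * (1 + 2*al) / (al * (1 + al))"
    proof -
      have e: "(real m + 1) * al\<^sup>2 = (1 - al) * (1 + al)" using al by (simp add: algebra_simps power2_eq_square)
      then have "1 - al \<noteq> 0" using al m0 by auto
      then have inv: "1 / (real m + 1) = al\<^sup>2 / ((1 - al) * (1 + al))"
        using e al m0 by (simp add: divide_simps mult.commute)
      have "2 / (real m + 1) * ((1 - al) / al) = 2 * (1 / (real m + 1)) * ((1 - al) / al)" by simp
      also have "\<dots> = 2 * al / (1 + al)"
        unfolding inv using \<open>1 - al \<noteq> 0\<close> al by (simp add: divide_simps power2_eq_square)
      finally have "2 / (real m + 1) * ((1 - al) / al) = 2 * al / (1 + al)" .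
      then show ?thesis using al by (simp add: divide_simps) (simp add: algebra_simps)
    qed
    finally show ?thesis using le by simp
  qed
  show ?thesis by (rule that[OF fin]) (use main in blast)
qed

theorem linf_max_proj_const_equiangular:
  fixes u :: "nat \<Rightarrow> nat \<Rightarrow> real"
  assumes m: "2 \<le> m" and N: "2 * N = m * (m + 1)"
    and al: "0 < al" "al\<^sup>2 * (real m + 2) = 1" and K: "0 < K"
    and diag: "\<And>i. i < N \<Longrightarrow> (\<Sum>a<m. u i a * u i a) = K"
    and off: "\<And>i j. i < N \<Longrightarrow> j < N \<Longrightarrow> i \<noteq> j \<Longrightarrow> \<bar>\<Sum>a<m. u i a * u j a\<bar> = al * K"
  shows "linf_max_proj_const m = (1 - al) * (1 + 2*al) / (al * (1 + al))" (is "_ = ?C")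
proof -
  have m1: "1 \<le> m" using m by simp
  obtain Y :: "linf set" where Y: "fin_dim_subspace m Y"
    "\<forall>P. bounded_linear P \<and> range P = Y \<and> (\<forall>y\<in>Y. P y = y) \<longrightarrow> ?C \<le> onorm P"
    by (rule equiangular_projection_bound[where u = u, OF m1 N al K diag off])
  have up: "rel_proj_const Z \<le> ?C" if "fin_dim_subspace m Z" for Z :: "linf set"
    by (rule rel_proj_const_le[OF that m al])
  have "?C \<le> rel_proj_const Y"
    unfolding rel_proj_const_def
  proof (rule cInf_greatest)
    \<comment> \<open>The infimum is over a nonempty set; the error 1 is an arbitrary
      choice.\<close>
    obtain P where "bounded_linear P" "range P = Y" "\<forall>y\<in>Y. P y = y"
      by (rule projection_exists[OF Y(1) m al zero_less_one])
    then show "{onorm P | P. bounded_linear P \<and> range P = Y \<and> (\<forall>y\<in>Y. P y = y)} \<noteq> {}" by blast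
  qed (use Y(2) in auto)
  also have "\<dots> \<le> linf_max_proj_const m"
    unfolding linf_max_proj_const_def using Y(1) up
    by (intro cSUP_upper bdd_aboveI[of _ ?C]) auto
  finally have "?C \<le> linf_max_proj_const m" .
  moreover have "linf_max_proj_const m \<le> ?C"
    unfolding linf_max_proj_const_def using Y(1) up by (intro cSUP_least) auto
  ultimately show ?thesis by simp
qed

section \<open>Extremal systems of equiangular lines\<close>

text \<open>One vertex from each antipodal pair of a regular icosahedron; \<open>g\<close> is the
  golden ratio.\<close>

definition icosa_vec :: "nat \<Rightarrow> nat \<Rightarrow> real" where
  "icosa_vec i a = (let g = (1 + sqrt 5) / 2 in
     [[0, 1, g], [0, 1, - g], [1, g, 0], [1, - g, 0], [g, 0, 1], [- g, 0, 1]] ! i ! a)"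

lemma icosa_vec_inner:
  "i < 6 \<Longrightarrow> (\<Sum>a<3. icosa_vec i a * icosa_vec i a) = (5 + sqrt 5) / 2"
  "i < 6 \<Longrightarrow> j < 6 \<Longrightarrow> i \<noteq> j \<Longrightarrow>
     \<bar>\<Sum>a<3. icosa_vec i a * icosa_vec j a\<bar> = 1 / sqrt 5 * ((5 + sqrt 5) / 2)"
proof -
  define g where "g = (1 + sqrt 5) / 2"
  \<comment> \<open>By this relation the squared lengths are \<open>g + 2\<close> and all other
    inner products are \<open>g\<close> or \<open>- g\<close>.\<close>
  have g: "g * g = g + 1" by (simp add: g_def field_simps)
  have g0: "0 < g" by (simp add: g_def add_pos_nonneg)
  have K: "(5 + sqrt 5) / 2 = g + 2" by (simp add: g_def field_simps)
  have K': "1 / sqrt 5 * ((5 + sqrt 5) / 2) = g" by (simp add: g_def field_simps)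
  have v: "icosa_vec i a = [[0, 1, g], [0, 1, - g], [1, g, 0], [1, - g, 0], [g, 0, 1], [- g, 0, 1]] ! i ! a" for i a
    by (simp add: icosa_vec_def g_def Let_def)
  have s3: "(\<Sum>a<3. f a) = f 0 + f 1 + f 2" for f :: "nat \<Rightarrow> real"
    by (simp add: eval_nat_numeral)
  have c6: "i = 0 \<or> i = 1 \<or> i = 2 \<or> i = 3 \<or> i = 4 \<or> i = 5" if "i < 6" for i :: nat
    using that by linarith
  show "(\<Sum>a<3. icosa_vec i a * icosa_vec i a) = (5 + sqrt 5) / 2" if "i < 6"
    unfolding K s3 v using c6[OF that] g by (elim disjE) (simp_all add: numeral_eq_Suc)
  show "\<bar>\<Sum>a<3. icosa_vec i a * icosa_vec j a\<bar> = 1 / sqrt 5 * ((5 + sqrt 5) / 2)"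
    if "i < 6" "j < 6" "i \<noteq> j"
    unfolding K' s3 v using c6[OF that(1)] c6[OF that(2)] that(3) g g0
    by (elim disjE) (simp_all add: numeral_eq_Suc)
qed

text \<open>One vertex from each opposite pair of a regular hexagon of radius 2.\<close>

definition hex_vec :: "nat \<Rightarrow> nat \<Rightarrow> real" where
  "hex_vec i a = [[2, 0], [-1, sqrt 3], [-1, - sqrt 3]] ! i ! a"

lemma hex_vec_inner:
  "i < 3 \<Longrightarrow> (\<Sum>a<2. hex_vec i a * hex_vec i a) = 4"
  "i < 3 \<Longrightarrow> j < 3 \<Longrightarrow> i \<noteq> j \<Longrightarrow> \<bar>\<Sum>a<2. hex_vec i a * hex_vec j a\<bar> = 1 / 2 * 4"
proof -
  have s2: "(\<Sum>a<2. f a) = f 0 + f 1" for f :: "nat \<Rightarrow> real"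
    by (simp add: eval_nat_numeral)
  have c3: "i = 0 \<or> i = 1 \<or> i = 2" if "i < 3" for i :: nat
    using that by linarith
  show "(\<Sum>a<2. hex_vec i a * hex_vec i a) = 4" if "i < 3"
    unfolding s2 hex_vec_def using c3[OF that] by (elim disjE) (simp_all add: numeral_eq_Suc)
  show "\<bar>\<Sum>a<2. hex_vec i a * hex_vec j a\<bar> = 1 / 2 * 4" if "i < 3" "j < 3" "i \<noteq> j"
    unfolding s2 hex_vec_def using c3[OF that(1)] c3[OF that(2)] that(3)
    by (elim disjE) (simp_all add: numeral_eq_Suc)
qed


text \<open>The supports are the lines \<open>{l, l + 1, l + 3}\<close> of the Fano plane on \<open>\<int>/7\<close>, each carrying all sign
  patterns up to a global sign.\<close>

definition fano_vec :: "nat \<times> real \<times> real \<Rightarrow> nat \<Rightarrow> real" where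
  "fano_vec = (\<lambda>(l, s, t) a. if a = l then 1 else if a = (l + 1) mod 7 then s
     else if a = (l + 3) mod 7 then t else 0)"

text \<open>Different lines of the Fano plane meet in one point, leaving a single term of size 1. On
  a common line, different sign patterns leave \<open>1 + s * s' + t * t'\<close> with at least one
  negative summand.\<close>

lemma fano_vec_inner:
  assumes "p \<in> {..<7} \<times> {1, -1} \<times> {1, -1}" "q \<in> {..<7} \<times> {1, -1} \<times> {1, -1}"
  shows "(\<Sum>a<7. fano_vec p a * fano_vec p a) = 3"
    and "p \<noteq> q \<Longrightarrow> \<bar>\<Sum>a<7. fano_vec p a * fano_vec q a\<bar> = 1"
proof -
  obtain l s t l' s' t' where p: "p = (l, s, t)" and q: "q = (l', s', t')" using prod_cases3 by metis
  have st: "\<bar>s\<bar> = 1" "\<bar>t\<bar> = 1" "\<bar>s'\<bar> = 1" "\<bar>t'\<bar> = 1" using assms by (auto simp: p q)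
  have ss: "s * s = 1" "t * t = 1" using assms by (auto simp: p)
  have s7: "(\<Sum>a<7. f a) = f 0 + f 1 + f 2 + f 3 + f 4 + f 5 + f 6" for f :: "nat \<Rightarrow> real"
    by (simp add: eval_nat_numeral)
  have c7: "i = 0 \<or> i = 1 \<or> i = 2 \<or> i = 3 \<or> i = 4 \<or> i = 5 \<or> i = 6" if "i < 7" for i :: nat
    using that by linarith
  have l: "l < 7" "l' < 7" using assms by (auto simp: p q)
  show "(\<Sum>a<7. fano_vec p a * fano_vec p a) = 3"
    unfolding s7 p fano_vec_def using c7[OF l(1)] ss by (elim disjE) simp_all
  show "\<bar>\<Sum>a<7. fano_vec p a * fano_vec q a\<bar> = 1" if "p \<noteq> q"
  proof (cases "l = l'")
    case True
    have "(s, t) \<noteq> (s', t')" using that True by (simp add: p q)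
    then have "\<bar>1 + s * s' + t * t'\<bar> = 1" using assms by (auto simp: p q)
    then show ?thesis
      unfolding s7 p q fano_vec_def True using c7[OF l(2)] by (elim disjE) (simp_all add: add_ac)
  next
    case False
    then show ?thesis
      unfolding s7 p q fano_vec_def using c7[OF l(1)] c7[OF l(2)] st
      by (elim disjE) (simp_all add: abs_mult)
  qed
qed

text \<open>The 253 blocks of the Steiner system S(4,7,23) form a single orbit of the base block under the
  group of maps \<open>x \<mapsto> 2\<^sup>k x + b\<close> on \<open>\<int>/23\<close>, which has order \<open>11 * 23\<close> because 2 has order 11.\<close>

definition witt_base :: "int list" where
  "witt_base = [0, 1, 2, 3, 5, 14, 17]"

definition affine23 :: "nat \<Rightarrow> int \<Rightarrow> int \<Rightarrow> int" where
  "affine23 k b x = (2 ^ k * x + b) mod 23"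

definition witt_block :: "nat \<Rightarrow> int \<Rightarrow> int set" where
  "witt_block k b = affine23 k b ` set witt_base"

text \<open>By the group action it is enough to compare the base block with its images; the filter
  counts the points of the base block that are mapped back into it.\<close>

lemma witt_base_meets:
  "list_all (\<lambda>k. list_all (\<lambda>b. k = 0 \<and> b = 0 \<or>
       length (filter (\<lambda>x. affine23 k b x \<in> set witt_base) witt_base) \<in> {1, 3}) [0..22]) [0..<11]"
  by code_simp

lemma witt_base_subset: "set witt_base \<subseteq> {0..<23}"
  by (simp add: witt_base_def)

lemma witt_block_subset: "witt_block k b \<subseteq> {0..<23}"
  by (auto simp: witt_block_def affine23_def)

text \<open>2 is invertible modulo 23.\<close>

lemma inj_on_affine23: "inj_on (affine23 k b) {0..<23}"
proof (rule inj_onI)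
  fix x y assume xy: "x \<in> {0..<23}" "y \<in> {0..<23}" "affine23 k b x = affine23 k b y"
  have "23 dvd (2 ^ k * x + b) - (2 ^ k * y + b)"
    using xy(3) unfolding affine23_def by (simp only: mod_eq_dvd_iff)
  then have "23 dvd 2 ^ k * (x - y)" by (simp add: algebra_simps)
  moreover have "coprime (23::int) (2 ^ k)"
    by (simp add: coprime_power_right_iff)
  ultimately have "23 dvd x - y" by (simp add: coprime_dvd_mult_right_iff)
  then have "x mod 23 = y mod 23" by (simp add: mod_eq_dvd_iff)
  then show "x = y" using xy by simp
qed

lemma card_witt_block: "card (witt_block k b) = 7"
proof -
  have "card (witt_block k b) = card (set witt_base)"
    unfolding witt_block_def by (intro card_image inj_on_subset[OF inj_on_affine23] witt_base_subset)
  then show ?thesis by (simp add: witt_base_def)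
qed

text \<open>The quotient of two group elements in normal form. As
  \<open>2^11 = 2048 = 1 + 23 * 89\<close>, the power \<open>2 ^ (11 - k)\<close> inverts
  \<open>2 ^ k\<close> modulo 23, which gives \<open>c\<close>, and \<open>n\<close> is
  \<open>l - k\<close> modulo 11.\<close>

lemma affine23_quotient:
  assumes "k < 11" "l < 11" "b \<in> {0..<23}" "b' \<in> {0..<23}" "(k, b) \<noteq> (l, b')"
  obtains n c where "n < 11" "c \<in> {0..<23}" "(n, c) \<noteq> (0, 0)"
    "\<forall>x. affine23 k b (affine23 n c x) = affine23 l b' x"
proof -
  define c where "c = (2 ^ (11 - k) * (b' - b)) mod 23"
  define n where "n = (if k \<le> l then l - k else l + 11 - k)"
  have kk: "(2::int) ^ k * 2 ^ (11 - k) = 2048"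
    using assms(1) by (simp add: power_add[symmetric])
  have kn: "(2::int) ^ k * 2 ^ n = 2 ^ l * (if k \<le> l then 1 else 2048)"
  proof (cases "k \<le> l")
    case False
    then have "k + n = l + 11" using assms by (simp add: n_def)
    then have "(2::int) ^ k * 2 ^ n = 2 ^ (l + 11)" by (metis power_add)
    then show ?thesis using False by (simp add: power_add)
  qed (simp add: n_def power_add[symmetric])
  have comp: "affine23 k b (affine23 n c x) = affine23 l b' x" for x
  proof -
    have "affine23 k b (affine23 n c x) = (2 ^ k * (2 ^ n * x + 2 ^ (11 - k) * (b' - b)) + b) mod 23"
      unfolding affine23_def c_def
      by (intro mod_add_cong refl) (simp only: mod_mult_right_eq mod_add_right_eq)
    also have "2 ^ k * (2 ^ n * x + 2 ^ (11 - k) * (b' - b)) + b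
        = (2 ^ k * 2 ^ n) * x + (2 ^ k * 2 ^ (11 - k)) * (b' - b) + b" by (simp add: algebra_simps)
    also have "\<dots> = 2 ^ l * (if k \<le> l then 1 else 2048) * x + 2048 * (b' - b) + b"
      by (simp only: kn kk)
    also have "\<dots> = 2 ^ l * x + b' + 23 * (89 * ((if k \<le> l then 0 else 2 ^ l * x) + (b' - b)))"
      by (simp add: algebra_simps)
    also have "\<dots> mod 23 = affine23 l b' x" unfolding affine23_def by (rule mod_mult_self2)
    finally show ?thesis .
  qed
  have "(n, c) \<noteq> (0, 0)"
  proof
    assume nc: "(n, c) = (0, 0)"
    then have "k = l" using assms(1) by (auto simp: n_def split: if_splits)
    moreover have "b = b'" using comp[of 0] nc assms(3,4) by (simp add: affine23_def)
    ultimately show False using assms(5) by simp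
  qed
  moreover have "n < 11" using assms(1,2) by (auto simp: n_def)
  moreover have "c \<in> {0..<23}" by (simp add: c_def)
  ultimately show ?thesis using comp by (intro that[of n c]) auto
qed

text \<open>Pulling both blocks back along the injective map \<open>affine23 k b\<close> turns them
  into the base block and its image under a group element other than the identity.\<close>

lemma witt_block_inter:
  assumes "k < 11" "l < 11" "b \<in> {0..<23}" "b' \<in> {0..<23}" "(k, b) \<noteq> (l, b')"
  shows "card (witt_block k b \<inter> witt_block l b') \<in> {1, 3}"
proof -
  obtain n c where n: "n < 11" and c: "c \<in> {0..<23}" and nc: "(n, c) \<noteq> (0, 0)"
    and comp: "\<forall>x. affine23 k b (affine23 n c x) = affine23 l b' x"
    by (rule affine23_quotient[OF assms])
  have "witt_block l b' = affine23 k b ` witt_block n c"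
    unfolding witt_block_def image_image using comp by simp
  then have "witt_block k b \<inter> witt_block l b' = affine23 k b ` (set witt_base \<inter> witt_block n c)"
    using inj_on_image_Int[OF inj_on_affine23 witt_base_subset witt_block_subset, of k b n c]
    by (simp add: witt_block_def)
  moreover have "inj_on (affine23 k b) (set witt_base \<inter> witt_block n c)"
    by (rule inj_on_subset[OF inj_on_affine23]) (use witt_base_subset in blast)
  ultimately have "card (witt_block k b \<inter> witt_block l b') = card (set witt_base \<inter> witt_block n c)"
    by (simp add: card_image)
  also have "set witt_base \<inter> witt_block n c
      = affine23 n c ` set (filter (\<lambda>x. affine23 n c x \<in> set witt_base) witt_base)"
    by (auto simp: witt_block_def)
  also have "card \<dots> = card (set (filter (\<lambda>x. affine23 n c x \<in> set witt_base) witt_base))"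
    by (intro card_image inj_on_subset[OF inj_on_affine23]) (use witt_base_subset in auto)
  also have "\<dots> = length (filter (\<lambda>x. affine23 n c x \<in> set witt_base) witt_base)"
    by (intro distinct_card distinct_filter) (simp add: witt_base_def)
  also have "\<dots> \<in> {1, 3}"
  proof -
    have "n \<in> set [0..<11]" "c \<in> set [0..22]" using n c by auto
    then have "n = 0 \<and> c = 0 \<or>
        length (filter (\<lambda>x. affine23 n c x \<in> set witt_base) witt_base) \<in> {1, 3}"
      using witt_base_meets unfolding list_all_iff by blast
    then show ?thesis using nc by blast
  qed
  finally show ?thesis .
qed

text \<open>The entries of \<open>witt_vec\<close> are affine in indicators, so this reduces their
  inner products to sizes of blocks and intersections.\<close>

lemma sum_indicator_affine_product:
  fixes A A' :: "int set"
  assumes "A \<subseteq> {0..<int n}" "A' \<subseteq> {0..<int n}"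
  shows "(\<Sum>a<n. (c * of_bool (int a \<in> A) + d) * (c' * of_bool (int a \<in> A') + d'))
    = c * c' * real (card (A \<inter> A')) + c * d' * real (card A) + c' * d * real (card A') + real n * d * d'"
proof -
  have ind: "(\<Sum>a<n. of_bool (int a \<in> C)) = real (card C)" if "C \<subseteq> {0..<int n}" for C
  proof -
    have "(\<Sum>a<n. of_bool (int a \<in> C)) = real (card ({..<n} \<inter> {a. int a \<in> C}))" by simp
    also have "card ({..<n} \<inter> {a. int a \<in> C}) = card (int ` ({..<n} \<inter> {a. int a \<in> C}))"
      by (simp add: card_image)
    also have "int ` ({..<n} \<inter> {a. int a \<in> C}) = C"
    proof
      show "C \<subseteq> int ` ({..<n} \<inter> {a. int a \<in> C})"
      proof
        fix x assume x: "x \<in> C"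
        then have "0 \<le> x" "x < int n" using that by auto
        then show "x \<in> int ` ({..<n} \<inter> {a. int a \<in> C})" using x
          by (intro image_eqI[of _ _ "nat x"]) auto
      qed
    qed auto
    finally show ?thesis .
  qed
  have "(\<Sum>a<n. (c * of_bool (int a \<in> A) + d) * (c' * of_bool (int a \<in> A') + d'))
      = (\<Sum>a<n. c * c' * of_bool (int a \<in> A \<inter> A') + c * d' * of_bool (int a \<in> A)
           + c' * d * of_bool (int a \<in> A') + d * d')"
    by (intro sum.cong refl) (auto simp: algebra_simps)
  also have "\<dots> = c * c' * (\<Sum>a<n. of_bool (int a \<in> A \<inter> A')) + c * d' * (\<Sum>a<n. of_bool (int a \<in> A))
           + c' * d * (\<Sum>a<n. of_bool (int a \<in> A')) + real n * d * d'"
    by (simp only: sum.distrib sum_distrib_left[symmetric]) simp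
  also have "\<dots> = c * c' * real (card (A \<inter> A')) + c * d' * real (card A) + c' * d * real (card A') + real n * d * d'"
    using assms by (subst (1 2 3) ind) auto
  finally show ?thesis .
qed

text \<open>These are, up to an isometry, the 276 lines obtained from the Leech lattice by projecting the
  minimal vectors at inner product 3 with a type 3 vector onto its orthogonal complement; the two
  constants solve the quadratic equations expressing that all inner products are \<open>\<plusminus>1\<close>.\<close>

definition witt_vec :: "int + nat \<times> int \<Rightarrow> nat \<Rightarrow> real" where
  "witt_vec p a = (case p of
     Inl i \<Rightarrow> 2 * of_bool (int a \<in> {i}) + (3 * sqrt 3 - 2) / 23
   | Inr (k, b) \<Rightarrow> 1 * of_bool (int a \<in> witt_block k b) + (- sqrt 3 - 7) / 23)"

text \<open>Two points give 5 if equal and 1 otherwise; a point and a block give 1 or -1 according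
  to incidence; two blocks give their intersection size, which is 7, 3 or 1, minus 2.\<close>

lemma witt_vec_inner:
  assumes p: "p \<in> {0..<23} <+> {..<11} \<times> {0..<23}" and q: "q \<in> {0..<23} <+> {..<11} \<times> {0..<23}"
  shows "(\<Sum>a<23. witt_vec p a * witt_vec p a) = 5"
    and "p \<noteq> q \<Longrightarrow> \<bar>\<Sum>a<23. witt_vec p a * witt_vec q a\<bar> = 1"
proof -
  note ip = sum_indicator_affine_product[where n = 23, simplified]
  have sub: "{i} \<subseteq> {0..<23::int}" if "i \<in> {0..<23}" for i using that by simp
  have pp: "(\<Sum>a<23. witt_vec (Inl i) a * witt_vec (Inl j) a) = 1 + 4 * of_bool (i = j)"
    if "i \<in> {0..<23}" "j \<in> {0..<23}" for i j
    unfolding witt_vec_def sum.case ip[OF sub[OF that(1)] sub[OF that(2)]]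
    by (cases "i = j") (simp_all add: field_simps)
  have bb: "(\<Sum>a<23. witt_vec (Inr (k, b)) a * witt_vec (Inr (l, c)) a)
      = real (card (witt_block k b \<inter> witt_block l c)) - 2" for k b l c
    unfolding witt_vec_def sum.case prod.case ip[OF witt_block_subset witt_block_subset]
    by (simp add: card_witt_block field_simps)
  have pb: "(\<Sum>a<23. witt_vec (Inl i) a * witt_vec (Inr (k, b)) a) = 2 * of_bool (i \<in> witt_block k b) - 1"
    if "i \<in> {0..<23}" for i k b
    unfolding witt_vec_def sum.case prod.case ip[OF sub[OF that] witt_block_subset]
    by (cases "i \<in> witt_block k b") (simp_all add: card_witt_block field_simps)
  have bp: "(\<Sum>a<23. witt_vec (Inr (k, b)) a * witt_vec (Inl i) a) = 2 * of_bool (i \<in> witt_block k b) - 1"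
    if "i \<in> {0..<23}" for i k b
    using pb[OF that, of k b] by (simp add: mult.commute)
  show "(\<Sum>a<23. witt_vec p a * witt_vec p a) = 5"
    using p by (auto simp: pp bb card_witt_block)
  show "\<bar>\<Sum>a<23. witt_vec p a * witt_vec q a\<bar> = 1" if "p \<noteq> q"
  proof -
    consider i j where "p = Inl i" "q = Inl j" "i \<in> {0..<23}" "j \<in> {0..<23}"
      | i k b where "p = Inl i" "q = Inr (k, b)" "i \<in> {0..<23}"
      | i k b where "p = Inr (k, b)" "q = Inl i" "i \<in> {0..<23}"
      | k b l c where "p = Inr (k, b)" "q = Inr (l, c)" "k < 11" "l < 11" "b \<in> {0..<23}" "c \<in> {0..<23}"
      using p q by (elim PlusE SigmaE) auto
    then show ?thesis
    proof cases
      case 1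
      then show ?thesis using that by (simp add: pp)
    next
      case 2
      then show ?thesis by (simp add: pb)
    next
      case 3
      then show ?thesis by (simp add: bp)
    next
      case 4
      then have "card (witt_block k b \<inter> witt_block l c) \<in> {1, 3}"
        using that by (intro witt_block_inter) auto
      then show ?thesis unfolding 4(1,2) bb by auto
    qed
  qed
qed

section \<open>Arbitrary finite index sets and the four constants\<close>

lemma linf_max_proj_const_equiangular_family:
  fixes u :: "'i \<Rightarrow> nat \<Rightarrow> real"
  assumes m: "2 \<le> m" and I: "finite I" "2 * card I = m * (m + 1)"
    and al: "0 < al" "al\<^sup>2 * (real m + 2) = 1" and K: "0 < K"
    and diag: "\<And>i. i \<in> I \<Longrightarrow> (\<Sum>a<m. u i a * u i a) = K"
    and off: "\<And>i j. i \<in> I \<Longrightarrow> j \<in> I \<Longrightarrow> i \<noteq> j \<Longrightarrow> \<bar>\<Sum>a<m. u i a * u j a\<bar> = al * K"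
  shows "linf_max_proj_const m = (1 - al) * (1 + 2*al) / (al * (1 + al))"
proof -
  obtain h where h: "bij_betw h {0..<card I} I" using ex_bij_betw_nat_finite[OF I(1)] by blast
  have hI: "h i \<in> I" if "i < card I" for i using bij_betwE[OF h] that by simp
  have inj: "h i \<noteq> h j" if "i < card I" "j < card I" "i \<noteq> j" for i j
    using bij_betw_imp_inj_on[OF h] that by (auto dest: inj_onD)
  show ?thesis
  proof (rule linf_max_proj_const_equiangular[where u = "\<lambda>i. u (h i)" and K = K, OF m I(2) al K])
    show "(\<Sum>a<m. u (h i) a * u (h i) a) = K" if "i < card I" for i
      by (rule diag[OF hI[OF that]])
    show "\<bar>\<Sum>a<m. u (h i) a * u (h j) a\<bar> = al * K" if "i < card I" "j < card I" "i \<noteq> j" for i j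
      by (rule off[OF hI[OF that(1)] hI[OF that(2)] inj[OF that]])
  qed
qed

lemma linf_max_proj_const_2: "linf_max_proj_const 2 = 4/3"
proof -
  have "linf_max_proj_const 2 = (1 - 1/2) * (1 + 2*(1/2)) / (1/2 * (1 + 1/2))"
    by (rule linf_max_proj_const_equiangular[where N = 3 and K = 4 and u = hex_vec])
       (auto simp: hex_vec_inner power_divide)
  then show ?thesis by simp
qed

lemma icosahedral_constant:
  "(1 - 1 / sqrt 5) * (1 + 2 * (1 / sqrt 5)) / (1 / sqrt 5 * (1 + 1 / sqrt 5)) = (1 + sqrt 5) / 2"
proof -
  define r where "r = sqrt 5"
  have r: "r * r = 5" "0 < r" by (simp_all add: r_def)
  have "(1 - 1 / r) * (1 + 2 * (1 / r)) / (1 / r * (1 + 1 / r)) = (r * r + r - 2) / (r + 1)"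
    using r(2) by (simp add: divide_simps) (simp add: algebra_simps)
  \<comment> \<open>With \<open>r * r = 5\<close> this amounts to
    \<open>(1 + r)^2 = 2 * (r + 3)\<close>.\<close>
  also have "\<dots> = (1 + r) / 2" using r by (simp add: divide_simps) (simp add: algebra_simps)
  finally show ?thesis by (simp add: r_def)
qed

lemma linf_max_proj_const_3: "linf_max_proj_const 3 = (1 + sqrt 5) / 2"
proof -
  have "linf_max_proj_const 3 = (1 - 1 / sqrt 5) * (1 + 2 * (1 / sqrt 5)) / (1 / sqrt 5 * (1 + 1 / sqrt 5))"
    by (rule linf_max_proj_const_equiangular[where N = 6 and K = "(5 + sqrt 5) / 2" and u = icosa_vec,
          OF _ _ _ _ _ icosa_vec_inner])
       (simp_all add: power_divide add_pos_nonneg)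
  then show ?thesis by (simp only: icosahedral_constant)
qed

lemma linf_max_proj_const_7: "linf_max_proj_const 7 = 5/2"
proof -
  have "linf_max_proj_const 7 = (1 - 1/3) * (1 + 2*(1/3)) / (1/3 * (1 + 1/3))"
  proof (rule linf_max_proj_const_equiangular_family[where K = 3 and u = fano_vec and
        I = "{..<7} \<times> {1, -1} \<times> {1, -1}"])
    show "(\<Sum>a<7. fano_vec p a * fano_vec p a) = 3" if "p \<in> {..<7} \<times> {1, -1} \<times> {1, -1}" for p
      by (rule fano_vec_inner[OF that that])
    show "\<bar>\<Sum>a<7. fano_vec p a * fano_vec q a\<bar> = 1/3 * 3"
      if "p \<in> {..<7} \<times> {1, -1} \<times> {1, -1}" "q \<in> {..<7} \<times> {1, -1} \<times> {1, -1}" "p \<noteq> q" for p q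
      using fano_vec_inner(2)[OF that] by simp
  qed (simp_all add: card_cartesian_product power_divide)
  then show ?thesis by simp
qed

lemma linf_max_proj_const_23: "linf_max_proj_const 23 = 14/3"
proof -
  have "linf_max_proj_const 23 = (1 - 1/5) * (1 + 2*(1/5)) / (1/5 * (1 + 1/5))"
  proof (rule linf_max_proj_const_equiangular_family[where K = 5 and u = witt_vec and
        I = "{0..<23} <+> {..<11} \<times> {0..<23}"])
    show "(\<Sum>a<23. witt_vec p a * witt_vec p a) = 5" if "p \<in> {0..<23} <+> {..<11} \<times> {0..<23}" for p
      by (rule witt_vec_inner[OF that that])
    show "\<bar>\<Sum>a<23. witt_vec p a * witt_vec q a\<bar> = 1/5 * 5"
      if "p \<in> {0..<23} <+> {..<11} \<times> {0..<23}" "q \<in> {0..<23} <+> {..<11} \<times> {0..<23}" "p \<noteq> q" for p q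
      using witt_vec_inner(2)[OF that] by simp
  \<comment> \<open>The number of lines is \<open>23 + 11 * 23 = 276\<close>, half of
    \<open>23 * 24\<close>.\<close>
  qed (simp_all add: card_cartesian_product card_Plus power_divide)
  then show ?thesis by simp
qed

theorem theorem6:
  fixes Y2 Y3 Y7 Y23 :: "'a::banach set"
  shows
    "((fin_dim_subspace 2 Y2 \<longrightarrow> rel_proj_const Y2 \<le> 4/3) \<and> linf_max_proj_const 2 = 4/3) \<and>
     ((fin_dim_subspace 3 Y3 \<longrightarrow> rel_proj_const Y3 \<le> (1 + sqrt 5)/2) \<and>
        linf_max_proj_const 3 = (1 + sqrt 5)/2) \<and>
     ((fin_dim_subspace 7 Y7 \<longrightarrow> rel_proj_const Y7 \<le> 5/2) \<and> linf_max_proj_const 7 = 5/2) \<and>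
     ((fin_dim_subspace 23 Y23 \<longrightarrow> rel_proj_const Y23 \<le> 14/3) \<and> linf_max_proj_const 23 = 14/3)"
proof -
  \<comment> \<open>The values of \<open>al = 1 / sqrt (m + 2)\<close> are \<open>1/2\<close>,
    \<open>1 / sqrt 5\<close>, \<open>1/3\<close> and \<open>1/5\<close>.\<close>
  have "rel_proj_const Y2 \<le> 4/3" if "fin_dim_subspace 2 Y2"
    using rel_proj_const_le[OF that, of "1/2"] by (simp add: power_divide)
  moreover have "rel_proj_const Y3 \<le> (1 + sqrt 5)/2" if "fin_dim_subspace 3 Y3"
    using rel_proj_const_le[OF that, of "1 / sqrt 5", unfolded icosahedral_constant]
    by (simp add: power_divide)
  moreover have "rel_proj_const Y7 \<le> 5/2" if "fin_dim_subspace 7 Y7"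
    using rel_proj_const_le[OF that, of "1/3"] by (simp add: power_divide)
  moreover have "rel_proj_const Y23 \<le> 14/3" if "fin_dim_subspace 23 Y23"
    using rel_proj_const_le[OF that, of "1/5"] by (simp add: power_divide)
  ultimately show ?thesis
    by (simp add: linf_max_proj_const_2 linf_max_proj_const_3 linf_max_proj_const_7 linf_max_proj_const_23)
qed

end
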